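(* Let $\mathcal M$ be a market (as defined in the context) that satisfies strong feasibility. Then there exist an allocation $X$ and a price vector $p$ that constitute a market equilibrium of $\mathcal M$.
   Context: A market $\mathcal M$ consists of a finite set $A$ of agents, a finite set $G$ of divisible goods, each with supply $1$, and a finite index set $C$. Each agent $i\in A$ has real coefficients $a_{ijk}$ ($j\in G,k\in C$), requirements $r_{ik}\ge 0$ ($k\in C$), delays $d_{ij}\ge 0$ ($j\in G$), and a budget $m_i>0$. An allocation is $X=(x_{ij})_{i\in A,j\in G}$ with $x_{ij}\ge 0$; write $\mathbf x_i=(x_{ij})_{j\in G}$. The covering constraints CC$(i)$ of agent $i$ are: $\sum_{j\in G}a_{ijk}x_{ij}\ge r_{ik}$ for all $k\in C$ and $x_{ij}\ge 0$ for all $j$. $X$ is supply respecting if $\sum_{i\in A}x_{ij}\le 1$ for all $j\in G$. Given prices $p\in\mathbb R_{\ge 0}^G$, an optimal bundle of agent $i$ is an optimal solution of the LP: minimize $\sum_j d_{ij}x_{ij}$ subject to CC$(i)$ and the budget constraint $\sum_j p_jx_{ij}\le m_i$. A pair $(X,p)$ is a market equilibrium if $X$ is supply respecting, each $\mathbf x_i$ is an optimal bundle of agent $i$ at prices $p$, and every good $j$ with $\sum_i x_{ij}<1$ has $p_j=0$. A bundle $\mathbf x_i$ is minimally feasible for CC$(i)$ if it satisfies CC$(i)$ and decreasing the amount of any single good with $x_{ij}>0$ makes CC$(i)$ violated. $\mathcal M$ satisfies strong feasibility if for every $S\subset A$ and every family $(\mathbf x_i)_{i\in S}$ where each $\mathbf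 x_i$ is minimally feasible for CC$(i)$ and the allocation (with $\mathbf x_i=0$ for $i\notin S$) is supply respecting, there exist bundles $(\mathbf x_i)_{i\in A\setminus S}$ satisfying CC$(i)$ for all $i\in A\setminus S$ such that the whole allocation $(\mathbf x_i)_{i\in A}$ is supply respecting. *)

theory Defs
  imports "HOL-Analysis.Analysis"
begin

record ('a, 'g, 'c) market =
  agents :: "'a set"
  goods :: "'g set"
  cidx :: "'c set"
  coef :: "'a \<Rightarrow> 'g \<Rightarrow> 'c \<Rightarrow> real"
  req :: "'a \<Rightarrow> 'c \<Rightarrow> real"
  delay :: "'a \<Rightarrow> 'g \<Rightarrow> real"
  budget :: "'a \<Rightarrow> real"

definition valid_market :: "('a, 'g, 'c) market \<Rightarrow> bool" where
  "valid_market M \<longleftrightarrow> finite (agents M) \<and> finite (goods M) \<and> finite (cidx M) \<and>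
     (\<forall>i\<in>agents M. \<forall>k\<in>cidx M. req M i k \<ge> 0) \<and>
     (\<forall>i\<in>agents M. \<forall>j\<in>goods M. delay M i j \<ge> 0) \<and>
     (\<forall>i\<in>agents M. budget M i > 0)"

definition CC :: "('a, 'g, 'c) market \<Rightarrow> 'a \<Rightarrow> ('g \<Rightarrow> real) \<Rightarrow> bool" where
  "CC M i x \<longleftrightarrow> (\<forall>k\<in>cidx M. (\<Sum>j\<in>goods M. coef M i j k * x j) \<ge> req M i k) \<and>
     (\<forall>j\<in>goods M. x j \<ge> 0)"

definition supply_respecting :: "('a, 'g, 'c) market \<Rightarrow> ('a \<Rightarrow> 'g \<Rightarrow> real) \<Rightarrow> bool" where
  "supply_respecting M X \<longleftrightarrow> (\<forall>j\<in>goods M. (\<Sum>i\<in>agents M. X i j) \<le> 1)"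

definition budget_feasible :: "('a, 'g, 'c) market \<Rightarrow> ('g \<Rightarrow> real) \<Rightarrow> 'a \<Rightarrow> ('g \<Rightarrow> real) \<Rightarrow> bool" where
  "budget_feasible M p i x \<longleftrightarrow> CC M i x \<and> (\<Sum>j\<in>goods M. p j * x j) \<le> budget M i"

definition optimal_bundle :: "('a, 'g, 'c) market \<Rightarrow> ('g \<Rightarrow> real) \<Rightarrow> 'a \<Rightarrow> ('g \<Rightarrow> real) \<Rightarrow> bool" where
  "optimal_bundle M p i x \<longleftrightarrow> budget_feasible M p i x \<and>
     (\<forall>y. budget_feasible M p i y \<longrightarrow>
        (\<Sum>j\<in>goods M. delay M i j * x j) \<le> (\<Sum>j\<in>goods M. delay M i j * y j))"

definition market_equilibrium :: "('a, 'g, 'c) market \<Rightarrow> ('a \<Rightarrow> 'g \<Rightarrow> real) \<Rightarrow> ('g \<Rightarrow> real) \<Rightarrow> bool" where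
  "market_equilibrium M X p \<longleftrightarrow>
     (\<forall>j\<in>goods M. p j \<ge> 0) \<and>
     (\<forall>i\<in>agents M. \<forall>j\<in>goods M. X i j \<ge> 0) \<and>
     supply_respecting M X \<and>
     (\<forall>i\<in>agents M. optimal_bundle M p i (X i)) \<and>
     (\<forall>j\<in>goods M. (\<Sum>i\<in>agents M. X i j) < 1 \<longrightarrow> p j = 0)"

definition minimally_feasible :: "('a, 'g, 'c) market \<Rightarrow> 'a \<Rightarrow> ('g \<Rightarrow> real) \<Rightarrow> bool" where
  "minimally_feasible M i x \<longleftrightarrow> CC M i x \<and>
     (\<forall>j\<in>goods M. x j > 0 \<longrightarrow> (\<forall>t. t < x j \<longrightarrow> \<not> CC M i (x(j := t))))"

definition strong_feasibility :: "('a, 'g, 'c) market \<Rightarrow> bool" where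
  "strong_feasibility M \<longleftrightarrow>
     (\<forall>S X. S \<subseteq> agents M \<longrightarrow>
        (\<forall>i\<in>S. minimally_feasible M i (X i)) \<longrightarrow>
        supply_respecting M (\<lambda>i. if i \<in> S then X i else (\<lambda>_. 0)) \<longrightarrow>
        (\<exists>Y. (\<forall>i\<in>agents M - S. CC M i (Y i)) \<and>
             supply_respecting M (\<lambda>i. if i \<in> S then X i else Y i)))"

end

theory Submission
  imports Defs
begin

text \<open>
  Relax the market: agent \<open>i\<close> may buy a bundle that meets only a fraction \<open>s \<le> 1\<close> of its
  requirements, at a penalty \<open>C * (1 - s)\<close> added to its delay. The zero bundle is then always
  affordable, so the Lagrange multiplier of the budget constraint is bounded, and a variational
  inequality (obtained from Brouwer's theorem) on bundles, fractions, multipliers and prices yields an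
  equilibrium of the relaxed market. If all multipliers \<open>\<lambda>\<^sub>i\<close> are kept above some \<open>\<epsilon> > 0\<close>, this
  equilibrium minimises the sum of the penalized delays with weights \<open>1 / \<lambda>\<^sub>i\<close> over all partial
  allocations that respect the supply. By strong feasibility the penalty is exact for this linear
  program, uniformly in the weights: serving the unserved agents in full never disturbs the agents
  that are already fully served. Hence \<open>s = 1\<close> for all agents, and \<open>\<epsilon> \<rightarrow> 0\<close> gives a market equilibrium.

  The types of agents and goods may be infinite, so there is no type of Euclidean space of the required
  dimension. Brouwer's theorem is therefore derived from Kuhn's lemma for cubes in \<open>nat \<Rightarrow> real\<close>.
\<close>

subsection \<open>Brouwer's theorem and variational inequalities in function spaces\<close>

lemma continuous_on_coordinate: "continuous_on S (\<lambda>z::'i \<Rightarrow> 'b::topological_space. z i)"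
  by (rule continuous_on_subset[OF continuous_on_product_coordinates]) auto

text \<open>Tychonoff's theorem: the box is a product of compact intervals, over an index type of
  any size. All compactness below comes from here.\<close>

lemma compact_function_box:
  fixes lo hi :: "'i \<Rightarrow> real"
  shows "compact {z. \<forall>i. lo i \<le> z i \<and> z i \<le> hi i}"
proof -
  have "compactin (product_topology (\<lambda>_. euclidean) UNIV) (PiE UNIV (\<lambda>i. {lo i..hi i}))"
    by (auto simp: compactin_PiE)
  moreover have "PiE UNIV (\<lambda>i. {lo i..hi i}) = {z. \<forall>i. lo i \<le> z i \<and> z i \<le> hi i}"
    by (auto simp: PiE_def Pi_def)
  ultimately show ?thesis
    by (simp add: euclidean_product_topology)
qed

section \<open>Brouwer's theorem on cubes, by Kuhn's combinatorial lemma\<close>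

definition unit_cube :: "nat \<Rightarrow> (nat \<Rightarrow> real) set" where
  "unit_cube n = {x. (\<forall>i<n. 0 \<le> x i \<and> x i \<le> 1) \<and> (\<forall>i\<ge>n. x i = 0)}"

lemma compact_unit_cube: "compact (unit_cube n)"
proof -
  have "unit_cube n = {x. \<forall>i. 0 \<le> x i \<and> x i \<le> (if i < n then 1 else 0)}"
    unfolding unit_cube_def by (auto simp: not_less intro: antisym)
  then show ?thesis
    using compact_function_box[of "\<lambda>_. 0" "\<lambda>i. if i < n then 1 else 0"] by simp
qed

text \<open>Kuhn's lemma on the grid of mesh \<open>1 / p\<close> yields one cell in which, for
  every coordinate \<open>i\<close>, two vertices carry different labels. The pair \<open>u\<close>,
  \<open>v\<close> may change with \<open>i\<close>, but all pairs lie near the same corner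
  \<open>z\<close>.\<close>

lemma unit_cube_sign_change:
  fixes f :: "(nat \<Rightarrow> real) \<Rightarrow> nat \<Rightarrow> real"
  assumes range: "\<And>x i. x \<in> unit_cube n \<Longrightarrow> i < n \<Longrightarrow> 0 \<le> f x i \<and> f x i \<le> 1"
    and "p > 0"
  obtains z where "z \<in> unit_cube n"
    and "\<And>i. i < n \<Longrightarrow> \<exists>u\<in>unit_cube n. \<exists>v\<in>unit_cube n.
           (\<forall>j. \<bar>u j - z j\<bar> \<le> 1 / real p) \<and> (\<forall>j. \<bar>v j - z j\<bar> \<le> 1 / real p) \<and>
           u i \<le> f u i \<and> f v i \<le> v i"
proof -
  define pt where "pt = (\<lambda>x::nat \<Rightarrow> nat. \<lambda>i. if i < n then real (x i) / real p else 0)"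
  \<comment> \<open>The label records the direction in which \<open>f\<close> moves coordinate
    \<open>i\<close>. Kuhn's lemma prescribes label 1 at \<open>x i = p\<close> and label 0 at
    \<open>x i = 0\<close>; \<open>range\<close> makes the prescribed labels agree with that
    direction.\<close>
  define lab where
    "lab = (\<lambda>x i. if x i = p \<or> x i \<noteq> 0 \<and> f (pt x) i \<le> pt x i then 1 else (0::nat))"
  have pt: "pt x \<in> unit_cube n" if "\<forall>i<n. x i \<le> p" for x
    using that \<open>p > 0\<close> by (auto simp: pt_def unit_cube_def)
  have lab1: "f (pt x) i \<le> pt x i" if "\<forall>i<n. x i \<le> p" "i < n" "lab x i = 1" for x i
    using that range[OF pt[OF that(1)] that(2)] \<open>p > 0\<close>
    by (auto simp: lab_def pt_def split: if_splits)
  have lab0: "pt x i \<le> f (pt x) i" if "\<forall>i<n. x i \<le> p" "i < n" "lab x i = 0" for x i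
    using that range[OF pt[OF that(1)] that(2)] \<open>p > 0\<close>
    by (auto simp: lab_def pt_def split: if_splits)
  obtain q where q: "\<forall>i<n. q i < p"
    and rs: "\<forall>i<n. \<exists>r s. (\<forall>j<n. q j \<le> r j \<and> r j \<le> q j + 1) \<and>
       (\<forall>j<n. q j \<le> s j \<and> s j \<le> q j + 1) \<and> lab r i \<noteq> lab s i"
    by (rule kuhn_lemma[of p n lab]) (use \<open>p > 0\<close> in \<open>auto simp: lab_def\<close>)
  show thesis
  proof
    show "pt q \<in> unit_cube n" using q by (intro pt) (auto intro: less_imp_le)
    fix i assume "i < n"
    have near: "\<forall>j. \<bar>pt x j - pt q j\<bar> \<le> 1 / real p"
      if "\<forall>j<n. q j \<le> x j \<and> x j \<le> q j + 1" for x
    proof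
      fix j
      have "\<bar>real (x j) - real (q j)\<bar> \<le> 1" if "j < n"
        using \<open>\<forall>j<n. q j \<le> x j \<and> x j \<le> q j + 1\<close> that by (auto simp: abs_le_iff)
      then show "\<bar>pt x j - pt q j\<bar> \<le> 1 / real p"
        using \<open>p > 0\<close> by (auto simp: pt_def diff_divide_distrib[symmetric] divide_right_mono)
    qed
    obtain r s where r: "\<forall>j<n. q j \<le> r j \<and> r j \<le> q j + 1"
      and s: "\<forall>j<n. q j \<le> s j \<and> s j \<le> q j + 1" and ne: "lab r i \<noteq> lab s i"
      using rs \<open>i < n\<close> by blast
    have r': "\<forall>j<n. r j \<le> p" and s': "\<forall>j<n. s j \<le> p"
      using r s q by (metis Suc_eq_plus1 Suc_leI le_trans)+
    have lab_cases: "lab x i = 0 \<or> lab x i = 1" for x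
      by (auto simp: lab_def)
    then consider "lab r i = 0" "lab s i = 1" | "lab r i = 1" "lab s i = 0"
      using ne by metis
    then show "\<exists>u\<in>unit_cube n. \<exists>v\<in>unit_cube n.
           (\<forall>j. \<bar>u j - pt q j\<bar> \<le> 1 / real p) \<and> (\<forall>j. \<bar>v j - pt q j\<bar> \<le> 1 / real p) \<and>
           u i \<le> f u i \<and> f v i \<le> v i"
    proof cases
      case 1
      then show ?thesis
        using pt[OF r'] pt[OF s'] near[OF r] near[OF s] lab0[OF r' \<open>i < n\<close>] lab1[OF s' \<open>i < n\<close>]
        by blast
    next
      case 2
      then show ?thesis
        using pt[OF r'] pt[OF s'] near[OF r] near[OF s] lab1[OF r' \<open>i < n\<close>] lab0[OF s' \<open>i < n\<close>]
        by blast
    qed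
  qed
qed

lemma tendsto_fun_iff:
  fixes f :: "'b \<Rightarrow> 'i \<Rightarrow> 'c::topological_space"
  shows "(f \<longlongrightarrow> l) F \<longleftrightarrow> (\<forall>i. ((\<lambda>x. f x i) \<longlongrightarrow> l i) F)"
  using limitin_componentwise[of "\<lambda>_. euclidean" UNIV f l F]
  by (simp add: euclidean_product_topology)

text \<open>The corners of ever finer cells have a limit point \<open>l\<close>. For each
  \<open>i\<close> the two vertices with opposite inequalities converge to \<open>l\<close> as well,
  and continuity turns the inequalities into \<open>f l i = l i\<close>.\<close>

theorem brouwer_unit_cube:
  fixes f :: "(nat \<Rightarrow> real) \<Rightarrow> nat \<Rightarrow> real"
  assumes cont: "\<And>i. i < n \<Longrightarrow> continuous_on (unit_cube n) (\<lambda>x. f x i)"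
    and range: "\<And>x i. x \<in> unit_cube n \<Longrightarrow> i < n \<Longrightarrow> 0 \<le> f x i \<and> f x i \<le> 1"
  obtains z where "z \<in> unit_cube n" and "\<And>i. i < n \<Longrightarrow> f z i = z i"
proof -
  have "\<exists>z\<in>unit_cube n. \<forall>i<n. \<exists>u\<in>unit_cube n. \<exists>v\<in>unit_cube n.
           (\<forall>j. \<bar>u j - z j\<bar> \<le> 1 / real (Suc p)) \<and> (\<forall>j. \<bar>v j - z j\<bar> \<le> 1 / real (Suc p)) \<and>
           u i \<le> f u i \<and> f v i \<le> v i" for p
    by (rule unit_cube_sign_change[of n f "Suc p", OF range]) auto
  then obtain z where z: "\<And>p. z p \<in> unit_cube n"
    and sign: "\<And>p i. i < n \<Longrightarrow> \<exists>u\<in>unit_cube n. \<exists>v\<in>unit_cube n.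
           (\<forall>j. \<bar>u j - z p j\<bar> \<le> 1 / real (Suc p)) \<and> (\<forall>j. \<bar>v j - z p j\<bar> \<le> 1 / real (Suc p)) \<and>
           u i \<le> f u i \<and> f v i \<le> v i"
    by metis
  have "seq_compact (unit_cube n)"
    by (simp add: compact_imp_seq_compact compact_unit_cube)
  then obtain l s where l: "l \<in> unit_cube n" and s: "strict_mono s"
    and lim: "(z \<circ> s) \<longlonglongrightarrow> l"
    using z by (metis seq_compactE)
  have lim_j: "(\<lambda>p. z (s p) j) \<longlonglongrightarrow> l j" for j
    using lim by (auto simp: tendsto_fun_iff o_def)
  have small: "(\<lambda>p. 1 / real (Suc (s p))) \<longlonglongrightarrow> 0"
    using LIMSEQ_subseq_LIMSEQ[OF lim_1_over_n[THEN LIMSEQ_Suc] s] by (simp add: o_def)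
  \<comment> \<open>This is stated for an arbitrary sequence \<open>w\<close> because the vertices
    \<open>u\<close> and \<open>v\<close>, which depend on \<open>i\<close>, are chosen only
    later.\<close>
  have near_lim: "w \<longlonglongrightarrow> l" if "\<And>p j. \<bar>w p j - z (s p) j\<bar> \<le> 1 / real (Suc (s p))" for w
    unfolding tendsto_fun_iff
  proof
    fix j
    have "(\<lambda>p. w p j - z (s p) j) \<longlonglongrightarrow> 0"
      by (rule tendsto_rabs_zero_cancel, rule tendsto_sandwich[OF _ _ tendsto_const small])
         (use that in auto)
    from tendsto_add[OF this lim_j[of j]] show "(\<lambda>p. w p j) \<longlonglongrightarrow> l j" by simp
  qed
  have "f l i = l i" if i: "i < n" for i
  proof -
    obtain u v where u: "\<And>p. u p \<in> unit_cube n" "\<And>p j. \<bar>u p j - z p j\<bar> \<le> 1 / real (Suc p)"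
        "\<And>p. u p i \<le> f (u p) i"
      and v: "\<And>p. v p \<in> unit_cube n" "\<And>p j. \<bar>v p j - z p j\<bar> \<le> 1 / real (Suc p)"
        "\<And>p. f (v p) i \<le> v p i"
      using sign[OF i] by metis
    have lims: "(\<lambda>p. f (w (s p)) i) \<longlonglongrightarrow> f l i" "(\<lambda>p. w (s p) i) \<longlonglongrightarrow> l i"
      if "\<And>p. w p \<in> unit_cube n" "\<And>p j. \<bar>w p j - z p j\<bar> \<le> 1 / real (Suc p)" for w
    proof -
      have w: "(\<lambda>p. w (s p)) \<longlonglongrightarrow> l"
        using that(2) by (intro near_lim)
      then show "(\<lambda>p. w (s p) i) \<longlonglongrightarrow> l i" by (simp add: tendsto_fun_iff)
      show "(\<lambda>p. f (w (s p)) i) \<longlonglongrightarrow> f l i"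
        using continuous_on_tendsto_compose[OF cont[OF i] w l] that(1) by simp
    qed
    have "l i \<le> f l i"
      using LIMSEQ_le[OF lims(2)[OF u(1,2)] lims(1)[OF u(1,2)]] u(3) by blast
    moreover have "f l i \<le> l i"
      using LIMSEQ_le[OF lims(1)[OF v(1,2)] lims(2)[OF v(1,2)]] v(3) by blast
    ultimately show ?thesis by simp
  qed
  with l that show thesis by blast
qed

section \<open>From fixed points on simplices to variational inequalities\<close>

definition std_simplex :: "nat \<Rightarrow> (nat \<Rightarrow> real) set" where
  "std_simplex n = {x. (\<forall>i. 0 \<le> x i) \<and> (\<forall>i\<ge>n. x i = 0) \<and> (\<Sum>i<n. x i) = 1}"

text \<open>If the coordinates sum to less than 1, the missing mass is spread evenly over them; if
  they sum to more than 1, they are rescaled. This carries Brouwer's theorem from the cube to the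
  simplex.\<close>

lemma std_simplex_retraction:
  assumes "n > 0"
  obtains r where "continuous_on (unit_cube n) r" and "r ` unit_cube n \<subseteq> std_simplex n"
    and "\<And>x. x \<in> std_simplex n \<Longrightarrow> r x = x"
proof -
  define s where "s = (\<lambda>x::nat \<Rightarrow> real. \<Sum>i<n. x i)"
  define r where "r = (\<lambda>x i. if i < n then (x i + max 0 (1 - s x) / real n) / max 1 (s x) else 0)"
  show thesis
  proof
    show "continuous_on (unit_cube n) r"
    proof (rule continuous_on_coordinatewise_then_product)
      fix i
      show "continuous_on (unit_cube n) (\<lambda>x. r x i)"
        unfolding r_def s_def
        by (cases "i < n") (auto intro!: continuous_intros continuous_on_coordinate)
    qed
    show "r ` unit_cube n \<subseteq> std_simplex n"
    proof (rule image_subsetI)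
      fix x assume x: "x \<in> unit_cube n"
      have "(\<Sum>i<n. r x i) = (\<Sum>i<n. x i + max 0 (1 - s x) / real n) / max 1 (s x)"
        by (simp add: r_def sum_divide_distrib)
      also have "(\<Sum>i<n. x i + max 0 (1 - s x) / real n) = max 1 (s x)"
        using \<open>n > 0\<close> by (simp add: sum.distrib s_def max_def)
      finally have "(\<Sum>i<n. r x i) = 1" by simp
      then show "r x \<in> std_simplex n"
        using x by (auto simp: std_simplex_def r_def unit_cube_def)
    qed
    show "r x = x" if "x \<in> std_simplex n" for x
      using that by (auto simp: r_def std_simplex_def s_def fun_eq_iff)
  qed
qed

text \<open>The map below is the one from Nash's proof of the existence of equilibria.\<close>

lemma simplex_variational:
  fixes \<psi> :: "(nat \<Rightarrow> real) \<Rightarrow> nat \<Rightarrow> real"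
  assumes "n > 0"
    and cont: "\<And>i. i < n \<Longrightarrow> continuous_on (std_simplex n) (\<lambda>x. \<psi> x i)"
    and nonpos: "\<And>x. x \<in> std_simplex n \<Longrightarrow> (\<Sum>i<n. x i * \<psi> x i) \<le> 0"
  obtains x where "x \<in> std_simplex n" and "\<And>i. i < n \<Longrightarrow> \<psi> x i \<le> 0"
proof -
  obtain r where r: "continuous_on (unit_cube n) r" "r ` unit_cube n \<subseteq> std_simplex n"
    "\<And>x. x \<in> std_simplex n \<Longrightarrow> r x = x"
    using std_simplex_retraction[OF \<open>n > 0\<close>] by metis
  define c where "c = (\<lambda>x. \<Sum>i<n. max 0 (\<psi> (r x) i))"
  \<comment> \<open>Precomposing with \<open>r\<close> defines the map on the whole cube. Its first
    \<open>n\<close> coordinates are nonnegative and sum to 1, so a fixed point in the cube lies in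
    the simplex, where \<open>r\<close> is the identity.\<close>
  define f where "f = (\<lambda>x i. (r x i + max 0 (\<psi> (r x) i)) / (1 + c x))"
  have c: "c x \<ge> 0" for x by (auto simp: c_def intro!: sum_nonneg)
  have sum_f: "(\<Sum>i<n. f x i) = 1" if "x \<in> unit_cube n" for x
  proof -
    have "(\<Sum>i<n. r x i) = 1" using r(2) that by (auto simp: std_simplex_def)
    then have "(\<Sum>i<n. r x i + max 0 (\<psi> (r x) i)) = 1 + c x"
      by (simp add: sum.distrib c_def)
    then show ?thesis
      using c[of x] by (simp add: f_def sum_divide_distrib[symmetric])
  qed
  have f0: "f x i \<ge> 0" if "x \<in> unit_cube n" for x i
    using r(2) that c[of x] by (auto simp: std_simplex_def f_def intro!: divide_nonneg_nonneg add_nonneg_nonneg)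
  obtain x where x: "x \<in> unit_cube n" "\<And>i. i < n \<Longrightarrow> f x i = x i"
  proof (rule brouwer_unit_cube[of n f])
    fix i assume i: "i < n"
    have ri: "continuous_on (unit_cube n) (\<lambda>x. r x j)" for j
      using r(1) by (rule continuous_on_product_then_coordinatewise)
    have "continuous_on (unit_cube n) (\<lambda>x. \<psi> (r x) j)" if "j < n" for j
      using continuous_on_compose2[OF cont[OF that] r(1) r(2)] .
    moreover from this have c_cont: "continuous_on (unit_cube n) c"
      unfolding c_def by (intro continuous_intros) auto
    ultimately show "continuous_on (unit_cube n) (\<lambda>x. f x i)"
      unfolding f_def using c i
      by (intro continuous_intros ri c_cont) (auto simp: add_nonneg_eq_0_iff)
  next
    fix x i assume "x \<in> unit_cube n" "i < n"
    then show "0 \<le> f x i \<and> f x i \<le> 1"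
      using f0 member_le_sum[of i "{..<n}" "f x"] sum_f[of x] by auto
  qed blast
  have xs: "x \<in> std_simplex n"
    using x sum_f[OF x(1)] by (auto simp: std_simplex_def unit_cube_def) (metis not_less order_refl)
  then have rx: "r x = x" by (rule r(3))
  have fix_eq: "max 0 (\<psi> x i) = c x * x i" if "i < n" for i
    using x(2)[OF that] c[of x] by (simp add: f_def rx field_simps)
  \<comment> \<open>Wherever \<open>x i > 0\<close>, the fixed point equation says
    \<open>\<psi> x i = c x * x i\<close>. The weighted sum in \<open>nonpos\<close> is therefore
    \<open>c x\<close> times a sum of squares that is positive on the simplex.\<close>
  have "c x = 0"
  proof (rule ccontr)
    assume "c x \<noteq> 0"
    then have "c x > 0" using c[of x] by simp
    have eq: "x i * \<psi> x i = c x * (x i)\<^sup>2" if "i < n" for i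
    proof (cases "x i = 0")
      case False
      then have "x i > 0" using xs by (auto simp: std_simplex_def order.not_eq_order_implies_strict)
      then have "max 0 (\<psi> x i) > 0" using fix_eq[OF that] \<open>c x > 0\<close> by simp
      then show ?thesis using fix_eq[OF that] by (auto simp: max_def power2_eq_square split: if_splits)
    qed simp
    have "(\<Sum>i<n. x i * \<psi> x i) = c x * (\<Sum>i<n. (x i)\<^sup>2)"
      by (simp add: sum_distrib_left eq)
    moreover have "(\<Sum>i<n. (x i)\<^sup>2) \<noteq> 0"
    proof
      assume "(\<Sum>i<n. (x i)\<^sup>2) = 0"
      then have "(\<Sum>i<n. x i) = 0" by (simp add: sum_nonneg_eq_0_iff)
      then show False using xs by (simp add: std_simplex_def)
    qed
    then have "(\<Sum>i<n. (x i)\<^sup>2) > 0"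
      by (simp add: sum_nonneg order.not_eq_order_implies_strict)
    ultimately show False
      using nonpos[OF xs] \<open>c x > 0\<close> by (simp add: mult_le_0_iff)
  qed
  then have "\<psi> x i \<le> 0" if "i < n" for i
    using fix_eq[OF that] by (auto simp: max_def split: if_splits)
  with xs that show thesis by blast
qed

text \<open>By compactness it suffices to satisfy the inequality for finitely many test points
  \<open>Y\<close> at once. The barycentric weights over \<open>Y\<close> form a simplex, on which
  the previous lemma applies. Convexity of \<open>K\<close> is expressed as closure under finite
  convex combinations.\<close>

theorem variational_inequality:
  fixes K :: "('i \<Rightarrow> real) set" and F :: "('i \<Rightarrow> real) \<Rightarrow> 'i \<Rightarrow> real"
  assumes "compact K" and "closed K" and "K \<noteq> {}"
    and conv: "\<And>n \<theta> y. \<theta> \<in> std_simplex n \<Longrightarrow> (\<And>k. k < n \<Longrightarrow> y k \<in> K) \<Longrightarrow>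
                 (\<lambda>i. \<Sum>k<n. \<theta> k * y k i) \<in> K"
    and cont: "\<And>i. i \<in> I \<Longrightarrow> continuous_on K (\<lambda>z. F z i)"
  obtains z where "z \<in> K" and "\<And>y. y \<in> K \<Longrightarrow> 0 \<le> (\<Sum>i\<in>I. F z i * (y i - z i))"
proof -
  define G where "G = (\<lambda>y. {z \<in> K. 0 \<le> (\<Sum>i\<in>I. F z i * (y i - z i))})"
  have "K \<inter> \<Inter>(G ` K) \<noteq> {}"
  proof (rule compact_imp_fip_image[OF \<open>compact K\<close>])
    fix y assume "y \<in> K"
    have "continuous_on K (\<lambda>z. \<Sum>i\<in>I. F z i * (y i - z i))"
      by (intro continuous_intros cont continuous_on_coordinate)
    then show "closed (G y)"
      unfolding G_def using \<open>closed K\<close> using continuous_closed_preimage[OF _ \<open>closed K\<close> closed_atLeast[of 0]]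
      by (simp add: vimage_def Int_def)
  next
    fix Y assume "finite Y" "Y \<subseteq> K"
    show "K \<inter> \<Inter>(G ` Y) \<noteq> {}"
    proof (cases "Y = {}")
      case True then show ?thesis using \<open>K \<noteq> {}\<close> by simp
    next
      case False
      define n where "n = card Y"
      obtain y where y: "bij_betw y {..<n} Y"
        using ex_bij_betw_nat_finite[OF \<open>finite Y\<close>] by (auto simp: n_def atLeast0LessThan)
      define z where "z = (\<lambda>\<theta> i. \<Sum>k<n. \<theta> k * y k i)"
      have yK: "y k \<in> K" if "k < n" for k
        using y \<open>Y \<subseteq> K\<close> that by (auto simp: bij_betw_def)
      have zK: "z \<theta> \<in> K" if "\<theta> \<in> std_simplex n" for \<theta>
        unfolding z_def by (rule conv[OF that yK])
      have z_cont: "continuous_on (std_simplex n) z"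
        unfolding z_def by (intro continuous_on_coordinatewise_then_product continuous_intros continuous_on_coordinate)
      \<comment> \<open>The \<open>\<theta>\<close>-weighted sum of these values is 0, since
        \<open>z \<theta>\<close> is itself the \<open>\<theta>\<close>-average of the points
        \<open>y k\<close>.\<close>
      define \<psi> where "\<psi> = (\<lambda>\<theta> k. - (\<Sum>i\<in>I. F (z \<theta>) i * (y k i - z \<theta> i)))"
      obtain \<theta> where \<theta>: "\<theta> \<in> std_simplex n" "\<And>k. k < n \<Longrightarrow> \<psi> \<theta> k \<le> 0"
      proof (rule simplex_variational[of n \<psi>])
        show "n > 0" using False \<open>finite Y\<close> by (simp add: n_def card_gt_0_iff)
      next
        fix k
        show "continuous_on (std_simplex n) (\<lambda>\<theta>. \<psi> \<theta> k)"
          unfolding \<psi>_def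
          by (intro continuous_intros continuous_on_compose2[OF cont z_cont]
                continuous_on_product_then_coordinatewise[OF z_cont]) (use zK in auto)
      next
        fix \<theta> assume \<theta>: "\<theta> \<in> std_simplex n"
        have "(\<Sum>k<n. \<theta> k * \<psi> \<theta> k) = - (\<Sum>i\<in>I. \<Sum>k<n. \<theta> k * (F (z \<theta>) i * (y k i - z \<theta> i)))"
          unfolding \<psi>_def by (simp add: sum_distrib_left sum_negf) (rule sum.swap)
        also have "\<dots> = - (\<Sum>i\<in>I. F (z \<theta>) i * ((\<Sum>k<n. \<theta> k * y k i) - (\<Sum>k<n. \<theta> k) * z \<theta> i))"
          by (simp add: sum_distrib_left sum_distrib_right algebra_simps sum_subtractf)
        also have "\<dots> = 0"
          using \<theta> by (simp add: std_simplex_def z_def)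
        finally show "(\<Sum>k<n. \<theta> k * \<psi> \<theta> k) \<le> 0" by simp
      qed blast
      have "z \<theta> \<in> G v" if v: "v \<in> Y" for v
      proof -
        obtain k where "k < n" "v = y k"
          using y v by (auto simp: bij_betw_def)
        then show ?thesis
          using \<theta>(2)[of k] zK[OF \<theta>(1)] by (simp add: G_def \<psi>_def)
      qed
      then show ?thesis using zK[OF \<theta>(1)] by blast
    qed
  qed
  then obtain z where "z \<in> K" "\<forall>y\<in>K. z \<in> G y" by blast
  then show thesis using that by (auto simp: G_def)
qed

subsection \<open>Minimally feasible bundles and the exact penalty\<close>

lemma closed_Collect_ball:
  assumes "\<And>k. k \<in> B \<Longrightarrow> closed {z. P k z}"
  shows "closed {z. \<forall>k\<in>B. P k z}"
  using assms by (simp add: Collect_ball_eq closed_INT)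

lemma closed_CC: "closed {x. CC M i x}"
  unfolding CC_def
  by (intro closed_Collect_conj closed_Collect_ball closed_Collect_le
        continuous_intros continuous_on_coordinate)

lemma CC_cong:
  assumes "\<And>j. j \<in> goods M \<Longrightarrow> x j = y j"
  shows "CC M i x \<longleftrightarrow> CC M i y"
  unfolding CC_def using assms by (simp cong: sum.cong)

text \<open>A bundle of least total amount among the feasible ones below \<open>x\<close> works:
  lowering one good while keeping \<open>CC\<close> would stay in \<open>K\<close> and reduce the
  total. Pinning the coordinates outside the goods to 0 makes \<open>K\<close> compact.\<close>

lemma minimally_feasible_below:
  assumes "finite (goods M)" and "CC M i x"
  obtains x' where "minimally_feasible M i x'" and "\<And>j. j \<in> goods M \<Longrightarrow> x' j \<le> x j"
proof -
  define B where "B = {z. \<forall>j. 0 \<le> z j \<and> z j \<le> (if j \<in> goods M then x j else 0)}"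
  define K where "K = B \<inter> {z. CC M i z}"
  have "compact K"
    unfolding K_def B_def by (rule compact_Int_closed[OF compact_function_box closed_CC])
  moreover have "(\<lambda>j. if j \<in> goods M then x j else 0) \<in> K"
    using assms CC_cong[of M x "\<lambda>j. if j \<in> goods M then x j else 0" i]
    by (auto simp: K_def B_def CC_def)
  moreover have "continuous_on K (\<lambda>z. \<Sum>j\<in>goods M. z j)"
    by (intro continuous_intros continuous_on_coordinate)
  ultimately obtain x' where x': "x' \<in> K"
    and least: "\<And>z. z \<in> K \<Longrightarrow> (\<Sum>j\<in>goods M. x' j) \<le> (\<Sum>j\<in>goods M. z j)"
    using continuous_attains_inf[of K "\<lambda>z. \<Sum>j\<in>goods M. z j"] by blast
  have "\<not> CC M i (x'(j := s))" if j: "j \<in> goods M" and "s < x' j" for j s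
  proof
    assume CC: "CC M i (x'(j := s))"
    then have "s \<ge> 0" using j by (auto simp: CC_def)
    have "x' \<in> B" using x' by (simp add: K_def)
    then have "x' j \<le> x j" using j by (auto simp: B_def dest: spec[of _ j])
    then have "x'(j := s) \<in> B"
      using \<open>x' \<in> B\<close> \<open>s \<ge> 0\<close> \<open>s < x' j\<close> j unfolding B_def by simp metis
    then have "x'(j := s) \<in> K"
      using CC by (simp add: K_def)
    then have "(\<Sum>j\<in>goods M. x' j) \<le> (\<Sum>j'\<in>goods M. (x'(j := s)) j')" by (rule least)
    moreover have "(\<Sum>j'\<in>goods M. (x'(j := s)) j') < (\<Sum>j\<in>goods M. x' j)"
      using assms(1) j \<open>s < x' j\<close> by (intro sum_strict_mono_ex1) auto
    ultimately show False by simp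
  qed
  then have "minimally_feasible M i x'"
    using x' by (auto simp: minimally_feasible_def K_def)
  moreover have "x' j \<le> x j" if "j \<in> goods M" for j
    using x' that by (auto simp: K_def B_def dest: spec[of _ j])
  ultimately show thesis by (rule that)
qed

text \<open>Here \<open>u\<close> and \<open>v\<close> are the slacks of finitely many constraints
  at two points. A step from \<open>u\<close> away from \<open>v\<close> keeps the tight constraints
  tight, and a short enough one keeps the others satisfied by continuity.\<close>

lemma ex_extend_beyond:
  fixes u v :: "'c \<Rightarrow> real"
  assumes "finite I" and "\<And>c. c \<in> I \<Longrightarrow> 0 \<le> u c" and "\<And>c. c \<in> I \<Longrightarrow> u c = 0 \<Longrightarrow> v c = 0"
  obtains \<eta> where "\<eta> > 0" and "\<And>c. c \<in> I \<Longrightarrow> 0 \<le> u c + \<eta> * (u c - v c)"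
proof -
  have "eventually (\<lambda>\<eta>. 0 \<le> u c + \<eta> * (u c - v c)) (at_right 0)" if c: "c \<in> I" for c
  proof (cases "u c = 0")
    case True
    then show ?thesis using assms(3)[OF c] by simp
  next
    case False
    have "((\<lambda>\<eta>. u c + \<eta> * (u c - v c)) \<longlongrightarrow> u c + 0 * (u c - v c)) (at_right 0)"
      by (intro tendsto_intros)
    moreover have "0 < u c + 0 * (u c - v c)" using False assms(2)[OF c] by simp
    ultimately have "eventually (\<lambda>\<eta>. 0 < u c + \<eta> * (u c - v c)) (at_right 0)"
      by (rule order_tendstoD)
    then show ?thesis by (rule eventually_mono) simp
  qed
  then have "eventually (\<lambda>\<eta>. \<forall>c\<in>I. 0 \<le> u c + \<eta> * (u c - v c)) (at_right 0)"
    using assms(1) by (simp add: eventually_ball_finite_distrib)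
  then have "eventually (\<lambda>\<eta>. 0 < \<eta> \<and> (\<forall>c\<in>I. 0 \<le> u c + \<eta> * (u c - v c))) (at_right (0::real))"
    using eventually_at_right_less[of "0::real"] by (rule eventually_conj[rotated])
  then show thesis
    using that eventually_happens'[OF trivial_limit_at_right_real] by blast
qed

text \<open>The tight set of a feasible point is a subset of the finite set \<open>H\<close>, so
  choosing one point for each tight set that occurs gives finitely many points.\<close>

lemma finite_tight_representatives:
  fixes H :: "('z \<Rightarrow> real) set"
  assumes "finite H"
  obtains R where "finite R" and "\<And>z h. z \<in> R \<Longrightarrow> h \<in> H \<Longrightarrow> 0 \<le> h z"
    and "\<And>z. (\<forall>h\<in>H. 0 \<le> h z) \<Longrightarrow> \<exists>z'\<in>R. \<forall>h\<in>H. h z' = 0 \<longleftrightarrow> h z = 0"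
proof -
  define Q where "Q = {z. \<forall>h\<in>H. 0 \<le> h z}"
  define tight where "tight = (\<lambda>z. {h \<in> H. h z = 0})"
  have "tight ` Q \<subseteq> Pow H" by (auto simp: tight_def)
  then have "finite (tight ` Q)" using assms by (meson finite_Pow_iff finite_subset)
  show thesis
  proof
    show "finite (inv_into Q tight ` (tight ` Q))"
      using \<open>finite (tight ` Q)\<close> by (rule finite_imageI)
    show "0 \<le> h z" if "z \<in> inv_into Q tight ` (tight ` Q)" "h \<in> H" for z h
    proof -
      have "z \<in> Q" using that(1) by (auto intro: inv_into_into)
      then show ?thesis using that(2) by (simp add: Q_def)
    qed
    show "\<exists>z'\<in>inv_into Q tight ` (tight ` Q). \<forall>h\<in>H. h z' = 0 \<longleftrightarrow> h z = 0"
      if "\<forall>h\<in>H. 0 \<le> h z" for z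
    proof -
      have "z \<in> Q" using that by (simp add: Q_def)
      then have "tight (inv_into Q tight (tight z)) = tight z"
        by (intro f_inv_into_f) auto
      then show ?thesis using \<open>z \<in> Q\<close> by (auto simp: tight_def set_eq_iff)
    qed
  qed
qed

section \<open>Fractional service and the exact penalty\<close>

definition scaled_CC :: "('a, 'g, 'c) market \<Rightarrow> 'a \<Rightarrow> ('g \<Rightarrow> real) \<Rightarrow> real \<Rightarrow> bool" where
  "scaled_CC M i x s \<longleftrightarrow> 0 \<le> s \<and> s \<le> 1 \<and>
     (\<forall>k\<in>cidx M. s * req M i k \<le> (\<Sum>j\<in>goods M. coef M i j k * x j)) \<and>
     (\<forall>j\<in>goods M. 0 \<le> x j)"

lemma scaled_CC_1: "scaled_CC M i x 1 \<longleftrightarrow> CC M i x"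
  by (simp add: scaled_CC_def CC_def)

lemma scaled_CC_0: "scaled_CC M i (\<lambda>_. 0) 0"
  by (simp add: scaled_CC_def)

definition partial_allocation ::
  "('a, 'g, 'c) market \<Rightarrow> ('a \<Rightarrow> 'g \<Rightarrow> real) \<Rightarrow> ('a \<Rightarrow> real) \<Rightarrow> bool" where
  "partial_allocation M X t \<longleftrightarrow>
     (\<forall>i\<in>agents M. scaled_CC M i (X i) (t i)) \<and> supply_respecting M X"

lemma partial_allocation_le_1:
  assumes "finite (agents M)" "partial_allocation M X t" "i \<in> agents M" "j \<in> goods M"
  shows "X i j \<le> 1"
proof -
  have "X i j \<le> (\<Sum>i\<in>agents M. X i j)"
    using assms by (intro member_le_sum) (auto simp: partial_allocation_def scaled_CC_def)
  also have "\<dots> \<le> 1"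
    using assms by (auto simp: partial_allocation_def supply_respecting_def)
  finally show ?thesis .
qed

text \<open>
  The points with the same set of tight constraints as \<open>(X, t)\<close> share one representative \<open>(X', t')\<close>, so
  only finitely many \<open>t'\<close> occur, whence \<open>\<delta>\<close>. Moving from \<open>(X, t)\<close> away from \<open>(X', t')\<close> stays feasible,
  so that \<open>(X', t')\<close> is optimal for every linear objective for which \<open>(X, t)\<close> is. This replaces an
  argument with the vertices of the polytope.
\<close>

lemma partial_allocation_representative:
  assumes "valid_market M"
  obtains \<delta> where "\<delta> > 0" and "\<And>X t. partial_allocation M X t \<Longrightarrow>
    \<exists>X' t' \<eta>. partial_allocation M X' t' \<and> \<eta> > 0 \<and>
      partial_allocation M (\<lambda>i j. X i j + \<eta> * (X i j - X' i j)) (\<lambda>i. t i + \<eta> * (t i - t' i)) \<and>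
      (\<forall>i\<in>agents M. (t i = 1 \<longrightarrow> t' i = 1) \<and> (t i < 1 \<longrightarrow> t' i \<le> 1 - \<delta>))"
proof -
  have fin: "finite (agents M)" "finite (goods M)" "finite (cidx M)"
    using assms by (auto simp: valid_market_def)
  \<comment> \<open>All constraints of a partial allocation, each written as an affine function that
    must be nonnegative.\<close>
  define H :: "(('a \<Rightarrow> 'b \<Rightarrow> real) \<times> ('a \<Rightarrow> real) \<Rightarrow> real) set" where "H =
    (\<lambda>(i, k) (X, t). (\<Sum>j\<in>goods M. coef M i j k * X i j) - t i * req M i k) ` (agents M \<times> cidx M) \<union>
    (\<lambda>(i, j) (X, t). X i j) ` (agents M \<times> goods M) \<union>
    (\<lambda>i (X, t). t i) ` agents M \<union>
    (\<lambda>i (X, t). 1 - t i) ` agents M \<union>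
    (\<lambda>j (X, t). 1 - (\<Sum>i\<in>agents M. X i j)) ` goods M"
  have "finite H" using fin by (simp add: H_def)
  have H_iff: "partial_allocation M X t \<longleftrightarrow> (\<forall>h\<in>H. 0 \<le> h (X, t))" for X t
    unfolding partial_allocation_def scaled_CC_def supply_respecting_def H_def
    by (auto simp: ball_Un)
  have H_affine: "h ((\<lambda>i j. X i j + \<eta> * (X i j - X' i j)), (\<lambda>i. t i + \<eta> * (t i - t' i)))
      = h (X, t) + \<eta> * (h (X, t) - h (X', t'))" if "h \<in> H" for h X t X' t' \<eta>
    using that unfolding H_def
    by (auto simp: algebra_simps sum.distrib sum_subtractf sum_distrib_left)
  obtain R where R: "finite R" "\<And>z h. z \<in> R \<Longrightarrow> h \<in> H \<Longrightarrow> 0 \<le> h z"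
    "\<And>z. (\<forall>h\<in>H. 0 \<le> h z) \<Longrightarrow> \<exists>z'\<in>R. \<forall>h\<in>H. h z' = 0 \<longleftrightarrow> h z = 0"
    using finite_tight_representatives[OF \<open>finite H\<close>] by blast
  \<comment> \<open>The positive shortfalls \<open>1 - t i\<close> occurring among the
    representatives. The inserted 1 keeps the set nonempty when there are none.\<close>
  define D where "D = insert 1 {d \<in> (\<lambda>((X, t), i). 1 - t i) ` (R \<times> agents M). 0 < d}"
  have "finite D" using R(1) fin by (simp add: D_def)
  define \<delta> where "\<delta> = Min D"
  have "\<delta> \<in> D" unfolding \<delta>_def using \<open>finite D\<close> by (intro Min_in) (auto simp: D_def)
  show thesis
  proof
    show "\<delta> > 0" using \<open>\<delta> \<in> D\<close> by (auto simp: D_def)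
    fix X t assume pa: "partial_allocation M X t"
    then obtain X' t' where R': "(X', t') \<in> R"
      and tight: "\<And>h. h \<in> H \<Longrightarrow> h (X', t') = 0 \<longleftrightarrow> h (X, t) = 0"
      using R(3)[of "(X, t)"] by (auto simp: H_iff)
    have pa': "partial_allocation M X' t'" using R(2)[OF R'] by (auto simp: H_iff)
    obtain \<eta> where \<eta>: "\<eta> > 0" "\<And>h. h \<in> H \<Longrightarrow> 0 \<le> h (X, t) + \<eta> * (h (X, t) - h (X', t'))"
      by (rule ex_extend_beyond[OF \<open>finite H\<close>, of "\<lambda>h. h (X, t)" "\<lambda>h. h (X', t')"])
         (use pa tight in \<open>auto simp: H_iff\<close>)
    have "(t i = 1 \<longrightarrow> t' i = 1) \<and> (t i < 1 \<longrightarrow> t' i \<le> 1 - \<delta>)" if i: "i \<in> agents M" for i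
    proof -
      \<comment> \<open>Being fully served is tightness of one of the constraints in
        \<open>H\<close>, so a point and its representative fully serve the same agents.\<close>
      have "(\<lambda>(X, t). 1 - t i) \<in> H" using i by (auto simp: H_def)
      from tight[OF this] have iff: "t' i = 1 \<longleftrightarrow> t i = 1" by auto
      moreover have "t' i \<le> 1 - \<delta>" if "t i < 1"
      proof -
        have "t' i \<le> 1" using pa' i by (auto simp: partial_allocation_def scaled_CC_def)
        then have "0 < 1 - t' i" using iff that by auto
        moreover have "1 - t' i \<in> (\<lambda>((X, t), i). 1 - t i) ` (R \<times> agents M)"
          using R' i by force
        ultimately have "1 - t' i \<in> D" by (simp add: D_def)
        then have "\<delta> \<le> 1 - t' i" unfolding \<delta>_def using \<open>finite D\<close> by (rule Min_le[rotated])
        then show ?thesis by simp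
      qed
      ultimately show ?thesis by blast
    qed
    moreover have "partial_allocation M (\<lambda>i j. X i j + \<eta> * (X i j - X' i j)) (\<lambda>i. t i + \<eta> * (t i - t' i))"
      using \<eta>(2) by (simp add: H_iff H_affine)
    ultimately show "\<exists>X' t' \<eta>. partial_allocation M X' t' \<and> \<eta> > 0 \<and>
      partial_allocation M (\<lambda>i j. X i j + \<eta> * (X i j - X' i j)) (\<lambda>i. t i + \<eta> * (t i - t' i)) \<and>
      (\<forall>i\<in>agents M. (t i = 1 \<longrightarrow> t' i = 1) \<and> (t i < 1 \<longrightarrow> t' i \<le> 1 - \<delta>))"
      using pa' \<eta>(1) by blast
  qed
qed

definition penalized_delay :: "('a, 'g, 'c) market \<Rightarrow> real \<Rightarrow> 'a \<Rightarrow> ('g \<Rightarrow> real) \<Rightarrow> real \<Rightarrow> real" where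
  "penalized_delay M C i x s = (\<Sum>j\<in>goods M. delay M i j * x j) + C * (1 - s)"

text \<open>\<open>C\<close> must not depend on the weights, which come from the equilibrium and degenerate as \<open>\<epsilon> \<rightarrow> 0\<close>.\<close>

lemma exact_penalty:
  assumes valid: "valid_market M" and sf: "strong_feasibility M"
  obtains C where "C > 0" and "\<And>w X t i. \<lbrakk>\<And>i. i \<in> agents M \<Longrightarrow> 0 < w i; partial_allocation M X t;
      \<And>X' t'. partial_allocation M X' t' \<Longrightarrow>
        (\<Sum>i\<in>agents M. w i * penalized_delay M C i (X i) (t i)) \<le>
        (\<Sum>i\<in>agents M. w i * penalized_delay M C i (X' i) (t' i));
      i \<in> agents M\<rbrakk> \<Longrightarrow> t i = 1"
proof -
  have fin: "finite (agents M)" "finite (goods M)"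
    and d0: "\<And>i j. i \<in> agents M \<Longrightarrow> j \<in> goods M \<Longrightarrow> 0 \<le> delay M i j"
    using valid by (auto simp: valid_market_def)
  obtain \<delta> where "\<delta> > 0" and rep: "\<And>X t. partial_allocation M X t \<Longrightarrow>
    \<exists>X' t' \<eta>. partial_allocation M X' t' \<and> \<eta> > 0 \<and>
      partial_allocation M (\<lambda>i j. X i j + \<eta> * (X i j - X' i j)) (\<lambda>i. t i + \<eta> * (t i - t' i)) \<and>
      (\<forall>i\<in>agents M. (t i = 1 \<longrightarrow> t' i = 1) \<and> (t i < 1 \<longrightarrow> t' i \<le> 1 - \<delta>))"
    using partial_allocation_representative[OF valid] by blast
  define D where "D = (\<Sum>i\<in>agents M. \<Sum>j\<in>goods M. delay M i j)"
  have "D \<ge> 0" unfolding D_def using d0 by (intro sum_nonneg)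
  \<comment> \<open>\<open>D\<close> bounds the delay of any one agent when the supply is respected,
    as all amounts are then at most 1. An agent not fully served by the representative pays a
    penalty of at least \<open>C * \<delta> = D + 1\<close>, more than any full service costs
    it.\<close>
  define C where "C = (D + 1) / \<delta>"
  show thesis
  proof
    show "C > 0" using \<open>\<delta> > 0\<close> \<open>D \<ge> 0\<close> by (simp add: C_def)
    fix w X t i0
    assume w: "\<And>i. i \<in> agents M \<Longrightarrow> 0 < w i" and pa: "partial_allocation M X t"
      and opt: "\<And>X' t'. partial_allocation M X' t' \<Longrightarrow>
        (\<Sum>i\<in>agents M. w i * penalized_delay M C i (X i) (t i)) \<le>
        (\<Sum>i\<in>agents M. w i * penalized_delay M C i (X' i) (t' i))"
      and i0: "i0 \<in> agents M"
    define f where "f = (\<lambda>X t. \<Sum>i\<in>agents M. w i * penalized_delay M C i (X i) (t i))"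
    obtain X' t' \<eta> where pa': "partial_allocation M X' t'" and "\<eta> > 0"
      and ext: "partial_allocation M (\<lambda>i j. X i j + \<eta> * (X i j - X' i j)) (\<lambda>i. t i + \<eta> * (t i - t' i))"
      and t': "\<And>i. i \<in> agents M \<Longrightarrow> t i = 1 \<Longrightarrow> t' i = 1"
        "\<And>i. i \<in> agents M \<Longrightarrow> t i < 1 \<Longrightarrow> t' i \<le> 1 - \<delta>"
      using rep[OF pa] by blast
    \<comment> \<open>The objective is affine, so a lower value at \<open>(X, t)\<close> than at the
      representative would make the extended point strictly better than the optimum.\<close>
    have "f (\<lambda>i j. X i j + \<eta> * (X i j - X' i j)) (\<lambda>i. t i + \<eta> * (t i - t' i))
        = f X t + \<eta> * (f X t - f X' t')"
      unfolding f_def penalized_delay_def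
      by (simp add: algebra_simps sum.distrib sum_subtractf sum_distrib_left)
    then have "0 \<le> \<eta> * (f X t - f X' t')" using opt[OF ext] by (simp add: f_def)
    then have f_le: "f X' t' \<le> f X t" using \<open>\<eta> > 0\<close> by (simp add: zero_le_mult_iff)
    define S where "S = {i \<in> agents M. t i = 1}"
    have scaled: "scaled_CC M i (X' i) (t' i)" if "i \<in> agents M" for i
      using pa' that by (simp add: partial_allocation_def)
    \<comment> \<open>Strong feasibility speaks of minimally feasible bundles, so the bundles of the
      fully served agents are trimmed first. Trimming does not raise their delay.\<close>
    have "\<exists>y. minimally_feasible M i y \<and> (\<forall>j\<in>goods M. y j \<le> X' i j)" if "i \<in> S" for i
    proof -
      have "CC M i (X' i)" using that scaled[of i] t'(1)[of i] by (simp add: S_def scaled_CC_1)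
      from minimally_feasible_below[OF fin(2) this] show ?thesis by metis
    qed
    then obtain Z where Z: "\<And>i. i \<in> S \<Longrightarrow> minimally_feasible M i (Z i)"
      "\<And>i j. i \<in> S \<Longrightarrow> j \<in> goods M \<Longrightarrow> Z i j \<le> X' i j"
      by metis
    have "supply_respecting M (\<lambda>i. if i \<in> S then Z i else (\<lambda>_. 0))"
      unfolding supply_respecting_def
    proof
      fix j assume j: "j \<in> goods M"
      have "(\<Sum>i\<in>agents M. (if i \<in> S then Z i else (\<lambda>_. 0)) j) \<le> (\<Sum>i\<in>agents M. X' i j)"
        using Z(2) scaled j by (intro sum_mono) (auto simp: scaled_CC_def)
      also have "\<dots> \<le> 1" using pa' j by (simp add: partial_allocation_def supply_respecting_def)
      finally show "(\<Sum>i\<in>agents M. (if i \<in> S then Z i else (\<lambda>_. 0)) j) \<le> 1" .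
    qed
    moreover have "S \<subseteq> agents M" by (auto simp: S_def)
    ultimately have "\<exists>Y. (\<forall>i\<in>agents M - S. CC M i (Y i)) \<and>
        supply_respecting M (\<lambda>i. if i \<in> S then Z i else Y i)"
      using sf[unfolded strong_feasibility_def, THEN spec, THEN spec, of S Z] Z(1) by simp
    then obtain Y where Y: "\<And>i. i \<in> agents M - S \<Longrightarrow> CC M i (Y i)"
      and sup: "supply_respecting M (\<lambda>i. if i \<in> S then Z i else Y i)"
      by blast
    define W where "W = (\<lambda>i. if i \<in> S then Z i else Y i)"
    have CCW: "CC M i (W i)" if "i \<in> agents M" for i
      using Y[of i] Z(1)[of i] that by (auto simp: W_def minimally_feasible_def)
    then have paW: "partial_allocation M W (\<lambda>_. 1)"
      using sup by (simp add: partial_allocation_def scaled_CC_1 W_def)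
    have le: "f X' t' \<le> f W (\<lambda>_. 1)"
      using f_le opt[OF paW] by (simp add: f_def)
    have term_S: "w i * penalized_delay M C i (W i) 1 \<le> w i * penalized_delay M C i (X' i) (t' i)"
      if "i \<in> S" for i
    proof -
      have "i \<in> agents M" using that by (simp add: S_def)
      moreover have "(\<Sum>j\<in>goods M. delay M i j * W i j) \<le> (\<Sum>j\<in>goods M. delay M i j * X' i j)"
        using Z(2)[OF that] d0[OF \<open>i \<in> agents M\<close>] that
        by (intro sum_mono mult_left_mono) (auto simp: W_def)
      ultimately show ?thesis
        using t'(1)[of i] w[of i] that by (simp add: penalized_delay_def S_def)
    qed
    have term_T: "w i * penalized_delay M C i (W i) 1 < w i * penalized_delay M C i (X' i) (t' i)"
      if i: "i \<in> agents M" "i \<notin> S" for i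
    proof -
      have "t i < 1" using i pa by (force simp: S_def partial_allocation_def scaled_CC_def)
      then have "\<delta> \<le> 1 - t' i" using t'(2)[OF i(1)] by simp
      then have "D + 1 \<le> C * (1 - t' i)"
        using mult_left_mono[of \<delta> "1 - t' i" C] \<open>C > 0\<close> \<open>\<delta> > 0\<close> by (simp add: C_def)
      moreover have "0 \<le> (\<Sum>j\<in>goods M. delay M i j * X' i j)"
        using d0 i scaled[OF i(1)] by (intro sum_nonneg mult_nonneg_nonneg) (auto simp: scaled_CC_def)
      moreover have "(\<Sum>j\<in>goods M. delay M i j * W i j) \<le> D"
      proof -
        have "(\<Sum>j\<in>goods M. delay M i j * W i j) \<le> (\<Sum>j\<in>goods M. delay M i j * 1)"
          using d0 i partial_allocation_le_1[OF fin(1) paW i(1)]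
          by (intro sum_mono mult_left_mono) auto
        also have "\<dots> \<le> D"
          unfolding D_def using fin i d0
          by (simp, intro member_le_sum[where f = "\<lambda>i. \<Sum>j\<in>goods M. delay M i j"] sum_nonneg) auto
        finally show ?thesis .
      qed
      ultimately show ?thesis
        using w[OF i(1)] by (simp add: penalized_delay_def)
    qed
    show "t i0 = 1"
    proof (rule ccontr)
      assume "t i0 \<noteq> 1"
      then have "i0 \<notin> S" by (simp add: S_def)
      have "f W (\<lambda>_. 1) < f X' t'"
        unfolding f_def
      proof (rule sum_strict_mono_ex1[OF fin(1)])
        show "\<forall>i\<in>agents M. w i * penalized_delay M C i (W i) 1 \<le> w i * penalized_delay M C i (X' i) (t' i)"
          using term_S term_T by (metis less_imp_le)
      qed (use term_T[OF i0 \<open>i0 \<notin> S\<close>] i0 in blast)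
      with le show False by simp
    qed
  qed
qed

subsection \<open>The relaxed market\<close>

text \<open>\<open>Frac i\<close> is the served fraction of agent \<open>i\<close>, \<open>Mult i\<close> the multiplier of its budget constraint.\<close>

datatype ('a, 'g) coord = Good 'a 'g | Frac 'a | Mult 'a | Price 'g

text \<open>
  Reaching these bounds does no harm at a solution: \<open>2\<close> exceeds the supply, a multiplier of
  at least \<open>C / budget M i\<close> makes overspending worse than buying nothing, and no good that costs more
  than the total budget can be sold out. Coordinates outside the market are pinned to \<open>0\<close>.
\<close>

definition coord_upper :: "('a, 'g, 'c) market \<Rightarrow> real \<Rightarrow> ('a, 'g) coord \<Rightarrow> real" where
  "coord_upper M C v = (case v of
      Good i j \<Rightarrow> if i \<in> agents M \<and> j \<in> goods M then 2 else 0
    | Frac i \<Rightarrow> if i \<in> agents M then 1 else 0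
    | Mult i \<Rightarrow> if i \<in> agents M then 1 + (\<Sum>i\<in>agents M. C / budget M i) else 0
    | Price j \<Rightarrow> if j \<in> goods M then 1 + (\<Sum>i\<in>agents M. budget M i) else 0)"

definition coord_box :: "('a, 'g, 'c) market \<Rightarrow> real \<Rightarrow> (('a, 'g) coord \<Rightarrow> real) set" where
  "coord_box M C = {z. \<forall>v. 0 \<le> z v \<and> z v \<le> coord_upper M C v}"

definition spending :: "('a, 'g, 'c) market \<Rightarrow> (('a, 'g) coord \<Rightarrow> real) \<Rightarrow> ('g \<Rightarrow> real) \<Rightarrow> real" where
  "spending M z x = (\<Sum>j\<in>goods M. z (Price j) * x j)"

abbreviation holding :: "(('a, 'g) coord \<Rightarrow> real) \<Rightarrow> 'a \<Rightarrow> 'g \<Rightarrow> real" where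
  "holding z i \<equiv> (\<lambda>j. z (Good i j))"

lemma sum_coord:
  fixes h :: "('a, 'g) coord \<Rightarrow> real"
  assumes "finite A" "finite G"
  shows "(\<Sum>v\<in>(\<lambda>(i, j). Good i j) ` (A \<times> G) \<union> Frac ` A \<union> Mult ` A \<union> Price ` G. h v) =
    (\<Sum>i\<in>A. (\<Sum>j\<in>G. h (Good i j)) + h (Frac i) + h (Mult i)) + (\<Sum>j\<in>G. h (Price j))"
proof -
  have "(\<Sum>v\<in>(\<lambda>(i, j). Good i j) ` (A \<times> G). h v) = (\<Sum>i\<in>A. \<Sum>j\<in>G. h (Good i j))"
    using assms by (subst sum.reindex) (auto simp: inj_on_def sum.cartesian_product split_def)
  then show ?thesis
    using assms
    by (subst sum.union_disjoint; (subst sum.union_disjoint)?; (subst sum.union_disjoint)?)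
       (auto simp: sum.reindex inj_on_def sum.distrib)
qed

lemma sum_single:
  fixes h :: "'b \<Rightarrow> real"
  assumes "finite B" "b \<in> B" "\<And>c. c \<in> B \<Longrightarrow> c \<noteq> b \<Longrightarrow> h c = 0"
  shows "sum h B = h b"
  using sum.mono_neutral_right[of B "{b}" h] assms by auto

lemma scaled_CC_combination:
  assumes "\<theta> \<in> std_simplex n" and "\<And>k. k < n \<Longrightarrow> scaled_CC M i (x k) (s k)"
  shows "scaled_CC M i (\<lambda>j. \<Sum>k<n. \<theta> k * x k j) (\<Sum>k<n. \<theta> k * s k)"
proof -
  have \<theta>: "\<And>k. 0 \<le> \<theta> k" "(\<Sum>k<n. \<theta> k) = 1"
    using assms(1) by (auto simp: std_simplex_def)
  have s: "0 \<le> s k" "s k \<le> 1" if "k < n" for k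
    using assms(2)[OF that] by (auto simp: scaled_CC_def)
  have "(\<Sum>k<n. \<theta> k * s k) \<le> (\<Sum>k<n. \<theta> k * 1)"
    using \<theta> s by (intro sum_mono mult_left_mono) auto
  moreover have "0 \<le> (\<Sum>k<n. \<theta> k * s k)"
    using \<theta> s by (intro sum_nonneg) auto
  moreover have "(\<Sum>k<n. \<theta> k * s k) * req M i c \<le>
      (\<Sum>j\<in>goods M. coef M i j c * (\<Sum>k<n. \<theta> k * x k j))" if c: "c \<in> cidx M" for c
  proof -
    have "(\<Sum>k<n. \<theta> k * s k) * req M i c = (\<Sum>k<n. \<theta> k * (s k * req M i c))"
      by (simp add: sum_distrib_right mult.assoc)
    also have "\<dots> \<le> (\<Sum>k<n. \<theta> k * (\<Sum>j\<in>goods M. coef M i j c * x k j))"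
      using \<theta> c assms(2) by (intro sum_mono mult_left_mono) (auto simp: scaled_CC_def)
    also have "\<dots> = (\<Sum>k<n. \<Sum>j\<in>goods M. coef M i j c * (\<theta> k * x k j))"
      by (simp add: sum_distrib_left mult.left_commute)
    also have "\<dots> = (\<Sum>j\<in>goods M. coef M i j c * (\<Sum>k<n. \<theta> k * x k j))"
      by (subst sum.swap) (simp add: sum_distrib_left)
    finally show ?thesis .
  qed
  moreover have "0 \<le> (\<Sum>k<n. \<theta> k * x k j)" if "j \<in> goods M" for j
    using \<theta> that assms(2) by (intro sum_nonneg mult_nonneg_nonneg) (auto simp: scaled_CC_def)
  ultimately show ?thesis using \<theta> by (simp add: scaled_CC_def)
qed

lemma continuous_on_spending:
  "continuous_on S (\<lambda>z. spending M z (holding z i))" "continuous_on S (\<lambda>z. spending M z y)"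
  unfolding spending_def by (intro continuous_intros continuous_on_coordinate)+

text \<open>The variational inequality is tested at points that change one agent's bundle and
  fraction, one multiplier, or one price. It thus splits into separate optimality conditions, from
  which overspending and then excess demand are excluded.\<close>

lemma relaxed_equilibrium:
  assumes valid: "valid_market M" and "C > 0" and "0 < \<epsilon>" and "\<epsilon> \<le> 1"
  obtains z where "z \<in> coord_box M C"
    and "\<And>i. i \<in> agents M \<Longrightarrow> \<epsilon> \<le> z (Mult i)"
    and "partial_allocation M (holding z) (\<lambda>i. z (Frac i))"
    and "\<And>i x s. \<lbrakk>i \<in> agents M; scaled_CC M i x s; \<And>j. j \<in> goods M \<Longrightarrow> x j \<le> 2\<rbrakk> \<Longrightarrow>
      penalized_delay M C i (holding z i) (z (Frac i)) + z (Mult i) * spending M z (holding z i) \<le>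
      penalized_delay M C i x s + z (Mult i) * spending M z x"
    and "\<And>i. i \<in> agents M \<Longrightarrow> spending M z (holding z i) \<le> budget M i"
    and "\<And>i. i \<in> agents M \<Longrightarrow>
      (z (Mult i) - \<epsilon>) * (budget M i - spending M z (holding z i)) \<le> 0"
    and "\<And>j. j \<in> goods M \<Longrightarrow> z (Price j) * (1 - (\<Sum>i\<in>agents M. z (Good i j))) = 0"
proof -
  let ?A = "agents M" and ?G = "goods M"
  have fin: "finite ?A" "finite ?G" and m0: "\<And>i. i \<in> ?A \<Longrightarrow> 0 < budget M i"
    and d0: "\<And>i j. i \<in> ?A \<Longrightarrow> j \<in> ?G \<Longrightarrow> 0 \<le> delay M i j"
    using valid by (auto simp: valid_market_def)
  define \<Lambda> where "\<Lambda> = 1 + (\<Sum>i\<in>?A. C / budget M i)"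
  define P where "P = 1 + (\<Sum>i\<in>?A. budget M i)"
  have \<Lambda>: "C \<le> \<Lambda> * budget M i" if "i \<in> ?A" for i
  proof -
    have "C / budget M i \<le> (\<Sum>i\<in>?A. C / budget M i)"
      using fin that m0 \<open>C > 0\<close> by (intro member_le_sum) (auto intro: less_imp_le)
    then have "C / budget M i \<le> \<Lambda>" by (simp add: \<Lambda>_def)
    then show ?thesis using m0[OF that] by (simp add: pos_divide_le_eq)
  qed
  have "\<Lambda> \<ge> 1"
    using m0 \<open>C > 0\<close> by (auto simp: \<Lambda>_def intro!: sum_nonneg divide_nonneg_pos)
  have "P \<ge> 1"
    using sum_nonneg[of ?A "budget M"] m0 by (simp add: P_def less_imp_le)
  define K where "K = coord_box M C \<inter>
    {z. \<forall>i\<in>?A. \<epsilon> \<le> z (Mult i) \<and> scaled_CC M i (holding z i) (z (Frac i))}"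
  define I where "I = (\<lambda>(i, j). Good i j) ` (?A \<times> ?G) \<union> Frac ` ?A \<union> Mult ` ?A \<union> Price ` ?G"
  \<comment> \<open>On \<open>Good\<close> and \<open>Frac\<close> this is the gradient of the
    agent's Lagrangian. On \<open>Mult\<close> and \<open>Price\<close> the signs are such that
    overspending pushes the multiplier up and excess demand pushes the price up.\<close>
  define F where "F = (\<lambda>z v. case v of
      Good i j \<Rightarrow> delay M i j + z (Mult i) * z (Price j)
    | Frac i \<Rightarrow> - C
    | Mult i \<Rightarrow> budget M i - spending M z (holding z i)
    | Price j \<Rightarrow> 1 - (\<Sum>i\<in>?A. z (Good i j)))"
  have box: "coord_box M C = {z. \<forall>v. (\<lambda>_. 0) v \<le> z v \<and> z v \<le> coord_upper M C v}"
    by (simp add: coord_box_def)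
  have cl: "closed {z :: ('a, 'b) coord \<Rightarrow> real.
      \<forall>i\<in>?A. \<epsilon> \<le> z (Mult i) \<and> scaled_CC M i (holding z i) (z (Frac i))}"
    unfolding scaled_CC_def
    by (intro closed_Collect_conj closed_Collect_ball closed_Collect_le
        continuous_intros continuous_on_coordinate)
  have "compact K"
    unfolding K_def box by (rule compact_Int_closed[OF compact_function_box cl])
  have "closed (coord_box M C)"
    unfolding coord_box_def
    by (intro closed_Collect_all closed_Collect_conj closed_Collect_le
        continuous_intros continuous_on_coordinate)
  then have "closed K" unfolding K_def using cl by (rule closed_Int)
  \<comment> \<open>Nobody buys anything and all fractions are 0; only the multipliers must be
    positive, because of the lower bound \<epsilon>.\<close>
  have "(\<lambda>v. case v of Mult i \<Rightarrow> if i \<in> ?A then \<Lambda> else 0 | _ \<Rightarrow> 0) \<in> K"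
    using \<open>\<Lambda> \<ge> 1\<close> \<open>\<epsilon> \<le> 1\<close> \<open>P \<ge> 1\<close> scaled_CC_0
    by (auto simp: K_def coord_box_def coord_upper_def \<Lambda>_def P_def split: coord.split)
  then have "K \<noteq> {}" by blast
  obtain z where zK: "z \<in> K" and vi: "\<And>y. y \<in> K \<Longrightarrow> 0 \<le> (\<Sum>v\<in>I. F z v * (y v - z v))"
  proof (rule variational_inequality[OF \<open>compact K\<close> \<open>closed K\<close> \<open>K \<noteq> {}\<close>, where F = F and I = I])
    fix n \<theta> and y :: "nat \<Rightarrow> ('a, 'b) coord \<Rightarrow> real"
    assume \<theta>: "\<theta> \<in> std_simplex n" and y: "\<And>k. k < n \<Longrightarrow> y k \<in> K"
    have \<theta>': "\<And>k. 0 \<le> \<theta> k" "(\<Sum>k<n. \<theta> k) = 1"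
      using \<theta> by (auto simp: std_simplex_def)
    have "(\<lambda>v. \<Sum>k<n. \<theta> k * y k v) \<in> coord_box M C"
      unfolding coord_box_def
    proof safe
      fix v
      have yv: "0 \<le> y k v" "y k v \<le> coord_upper M C v" if "k < n" for k
        using y[OF that] by (auto simp: K_def coord_box_def)
      show "0 \<le> (\<Sum>k<n. \<theta> k * y k v)" using \<theta>' yv by (intro sum_nonneg) auto
      have "(\<Sum>k<n. \<theta> k * y k v) \<le> (\<Sum>k<n. \<theta> k * coord_upper M C v)"
        using \<theta>' yv by (intro sum_mono mult_left_mono) auto
      then show "(\<Sum>k<n. \<theta> k * y k v) \<le> coord_upper M C v"
        using \<theta>' by (simp add: sum_distrib_right[symmetric])
    qed
    moreover have "\<epsilon> \<le> (\<Sum>k<n. \<theta> k * y k (Mult i))" if "i \<in> ?A" for i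
    proof -
      have "(\<Sum>k<n. \<theta> k * \<epsilon>) \<le> (\<Sum>k<n. \<theta> k * y k (Mult i))"
        using \<theta>' y that by (intro sum_mono mult_left_mono) (auto simp: K_def)
      then show ?thesis using \<theta>' by (simp add: sum_distrib_right[symmetric])
    qed
    moreover have "scaled_CC M i (\<lambda>j. \<Sum>k<n. \<theta> k * y k (Good i j)) (\<Sum>k<n. \<theta> k * y k (Frac i))"
      if "i \<in> ?A" for i
      using y that by (intro scaled_CC_combination[OF \<theta>]) (auto simp: K_def)
    ultimately show "(\<lambda>v. \<Sum>k<n. \<theta> k * y k v) \<in> K" by (simp add: K_def)
  next
    fix v
    show "continuous_on K (\<lambda>z. F z v)"
      unfolding F_def
      by (cases v) (auto intro!: continuous_intros continuous_on_coordinate continuous_on_spending)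
  qed blast
  have vi': "0 \<le> (\<Sum>i\<in>?A. (\<Sum>j\<in>?G. F z (Good i j) * (y (Good i j) - z (Good i j))) +
       F z (Frac i) * (y (Frac i) - z (Frac i)) + F z (Mult i) * (y (Mult i) - z (Mult i))) +
       (\<Sum>j\<in>?G. F z (Price j) * (y (Price j) - z (Price j)))" if "y \<in> K" for y
    using vi[OF that] unfolding I_def sum_coord[OF fin] .
  have z_box: "z \<in> coord_box M C" and z_mult: "\<And>i. i \<in> ?A \<Longrightarrow> \<epsilon> \<le> z (Mult i)"
    and z_CC: "\<And>i. i \<in> ?A \<Longrightarrow> scaled_CC M i (holding z i) (z (Frac i))"
    using zK by (auto simp: K_def)
  have z0: "0 \<le> z v" and z_up: "z v \<le> coord_upper M C v" for v
    using z_box by (auto simp: coord_box_def)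
  have agent: "penalized_delay M C i (holding z i) (z (Frac i)) + z (Mult i) * spending M z (holding z i) \<le>
      penalized_delay M C i x s + z (Mult i) * spending M z x"
    if i: "i \<in> ?A" and x: "scaled_CC M i x s" "\<And>j. j \<in> ?G \<Longrightarrow> x j \<le> 2" for i x s
  proof -
    \<comment> \<open>Outside the goods nothing is known about \<open>x\<close>, so the values of
      \<open>z\<close> are kept there to stay in the box.\<close>
    define y where "y = (\<lambda>v. case v of
        Good i' j \<Rightarrow> if i' = i \<and> j \<in> ?G then x j else z v
      | Frac i' \<Rightarrow> if i' = i then s else z v
      | _ \<Rightarrow> z v)"
    have y_other: "y (Good i' j) = z (Good i' j)" "y (Frac i') = z (Frac i')" if "i' \<noteq> i" for i' j
      using that by (auto simp: y_def)
    have y_same: "\<And>j. j \<in> ?G \<Longrightarrow> y (Good i j) = x j" "y (Frac i) = s"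
      "\<And>i. y (Mult i) = z (Mult i)" "\<And>j. y (Price j) = z (Price j)"
      by (auto simp: y_def)
    have "0 \<le> y v \<and> y v \<le> coord_upper M C v" for v
      using x i z0[of v] z_up[of v]
      by (cases v) (auto simp: y_def coord_upper_def scaled_CC_def)
    then have "y \<in> coord_box M C" by (simp add: coord_box_def)
    moreover have "scaled_CC M i' (holding y i') (y (Frac i'))" if "i' \<in> ?A" for i'
    proof (cases "i' = i")
      case True
      with x(1) show ?thesis by (simp add: scaled_CC_def y_same cong: sum.cong)
    qed (use z_CC[OF that] y_other in simp)
    ultimately have "y \<in> K" using z_mult by (simp add: K_def y_same)
    have "0 \<le> (\<Sum>i\<in>?A. (\<Sum>j\<in>?G. F z (Good i j) * (y (Good i j) - z (Good i j))) +
       F z (Frac i) * (y (Frac i) - z (Frac i)))"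
      using vi'[OF \<open>y \<in> K\<close>] by (simp add: y_same)
    also have "\<dots> = (\<Sum>j\<in>?G. F z (Good i j) * (y (Good i j) - z (Good i j))) +
       F z (Frac i) * (y (Frac i) - z (Frac i))"
      by (intro sum_single fin i) (simp add: y_other)
    also have "\<dots> = (\<Sum>j\<in>?G. (delay M i j + z (Mult i) * z (Price j)) * (x j - z (Good i j)))
        - C * (s - z (Frac i))"
      by (simp add: F_def y_same cong: sum.cong)
    finally show ?thesis
      by (simp add: penalized_delay_def spending_def algebra_simps sum.distrib sum_subtractf sum_distrib_left)
  qed
  have mult_vi: "0 \<le> (budget M i - spending M z (holding z i)) * (l - z (Mult i))"
    if i: "i \<in> ?A" and l: "\<epsilon> \<le> l" "l \<le> \<Lambda>" for i l
  proof -
    define y where "y = z(Mult i := l)"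
    have "y \<in> K"
      using zK i l \<open>0 < \<epsilon>\<close> by (auto simp: K_def coord_box_def y_def coord_upper_def \<Lambda>_def)
    have "0 \<le> (\<Sum>i\<in>?A. F z (Mult i) * (y (Mult i) - z (Mult i)))"
      using vi'[OF \<open>y \<in> K\<close>] by (simp add: y_def)
    also have "\<dots> = F z (Mult i) * (y (Mult i) - z (Mult i))"
      by (intro sum_single fin i) (simp add: y_def)
    finally show ?thesis by (simp add: F_def y_def)
  qed
  have price_vi: "0 \<le> (1 - (\<Sum>i\<in>?A. z (Good i j))) * (p - z (Price j))"
    if j: "j \<in> ?G" and p: "0 \<le> p" "p \<le> P" for j p
  proof -
    define y where "y = z(Price j := p)"
    have "y \<in> K"
      using zK j p by (auto simp: K_def coord_box_def y_def coord_upper_def P_def)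
    have "0 \<le> (\<Sum>j\<in>?G. F z (Price j) * (y (Price j) - z (Price j)))"
      using vi'[OF \<open>y \<in> K\<close>] by (simp add: y_def)
    also have "\<dots> = F z (Price j) * (y (Price j) - z (Price j))"
      by (intro sum_single fin j) (simp add: y_def)
    finally show ?thesis by (simp add: F_def y_def)
  qed
  have afford: "spending M z (holding z i) \<le> budget M i" if i: "i \<in> ?A" for i
  proof (rule ccontr)
    assume *: "\<not> ?thesis"
    have "z (Mult i) \<le> \<Lambda>" using z_up[of "Mult i"] i by (simp add: coord_upper_def \<Lambda>_def)
    moreover have "\<Lambda> \<le> z (Mult i)"
      using mult_vi[OF i, of \<Lambda>] * \<open>\<epsilon> \<le> 1\<close> \<open>\<Lambda> \<ge> 1\<close> by (auto simp: zero_le_mult_iff)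
    ultimately have l: "z (Mult i) = \<Lambda>" by simp
    have "0 \<le> (\<Sum>j\<in>?G. delay M i j * z (Good i j))"
      using d0 i z0 by (intro sum_nonneg) auto
    moreover have "0 \<le> C * z (Frac i)" using z0 \<open>C > 0\<close> by simp
    moreover have "z (Frac i) \<le> 1" using z_CC[OF i] by (simp add: scaled_CC_def)
    then have "C * z (Frac i) \<le> C" using \<open>C > 0\<close> by simp
    \<comment> \<open>The comparison is with the zero bundle at fraction 0, whose penalized delay is
      exactly \<open>C\<close>.\<close>
    ultimately have "\<Lambda> * spending M z (holding z i) \<le> C"
      using agent[OF i scaled_CC_0] by (simp add: penalized_delay_def spending_def l algebra_simps)
    also have "\<dots> \<le> \<Lambda> * budget M i" using \<Lambda>[OF i] .
    finally show False using * \<open>\<Lambda> \<ge> 1\<close> by simp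
  qed
  have clear: "(\<Sum>i\<in>?A. z (Good i j)) \<le> 1" if j: "j \<in> ?G" for j
  proof (rule ccontr)
    assume *: "\<not> ?thesis"
    have "P \<le> z (Price j)"
      using price_vi[OF j, of P] * \<open>P \<ge> 1\<close> by (auto simp: zero_le_mult_iff)
    have "P * 1 \<le> P * (\<Sum>i\<in>?A. z (Good i j))"
      using * \<open>P \<ge> 1\<close> by (intro mult_left_mono) auto
    also have "\<dots> \<le> z (Price j) * (\<Sum>i\<in>?A. z (Good i j))"
      using \<open>P \<le> z (Price j)\<close> z0 by (intro mult_right_mono sum_nonneg) auto
    also have "\<dots> = (\<Sum>i\<in>?A. z (Price j) * z (Good i j))" by (simp add: sum_distrib_left)
    also have "\<dots> \<le> (\<Sum>i\<in>?A. spending M z (holding z i))"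
      unfolding spending_def using fin j z0 by (intro sum_mono member_le_sum) auto
    also have "\<dots> \<le> (\<Sum>i\<in>?A. budget M i)" using afford by (rule sum_mono)
    finally show False by (simp add: P_def)
  qed
  show thesis
  proof (rule that[OF z_box])
    show "partial_allocation M (holding z) (\<lambda>i. z (Frac i))"
      using z_CC clear by (simp add: partial_allocation_def supply_respecting_def)
    \<comment> \<open>The test value is the least admissible multiplier. Together with
      \<open>afford\<close>, this says that an agent with money left has multiplier
      \<epsilon>.\<close>
    show "(z (Mult i) - \<epsilon>) * (budget M i - spending M z (holding z i)) \<le> 0" if "i \<in> ?A" for i
      using mult_vi[OF that, of \<epsilon>] \<open>\<epsilon> \<le> 1\<close> \<open>\<Lambda> \<ge> 1\<close> by (simp add: algebra_simps)
    show "z (Price j) * (1 - (\<Sum>i\<in>?A. z (Good i j))) = 0" if "j \<in> ?G" for j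
    proof (rule antisym)
      show "z (Price j) * (1 - (\<Sum>i\<in>?A. z (Good i j))) \<le> 0"
        using price_vi[OF that, of 0] \<open>P \<ge> 1\<close> by (simp add: mult.commute)
      show "0 \<le> z (Price j) * (1 - (\<Sum>i\<in>?A. z (Good i j)))"
        using clear[OF that] z0 by simp
    qed
  qed (use z_mult agent afford in blast)+
qed

text \<open>
  Apart from the \<open>\<epsilon>\<close> in complementary slackness for the budget, these are the Kuhn-Tucker conditions of
  a market equilibrium. They are closed conditions, and the set is monotone in \<open>\<epsilon>\<close>.
\<close>

definition near_equilibria :: "('a, 'g, 'c) market \<Rightarrow> real \<Rightarrow> (('a, 'g) coord \<Rightarrow> real) set" where
  "near_equilibria M \<epsilon> = {z.
     (\<forall>i\<in>agents M. CC M i (holding z i) \<and> spending M z (holding z i) \<le> budget M i \<and>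
        z (Mult i) * (budget M i - spending M z (holding z i)) \<le> \<epsilon> * budget M i \<and>
        (\<forall>y\<in>{y. CC M i y}.
           (\<Sum>j\<in>goods M. delay M i j * z (Good i j)) + z (Mult i) * spending M z (holding z i) \<le>
           (\<Sum>j\<in>goods M. delay M i j * y j) + z (Mult i) * spending M z y)) \<and>
     (\<forall>j\<in>goods M. (\<Sum>i\<in>agents M. z (Good i j)) \<le> 1 \<and>
        z (Price j) * (1 - (\<Sum>i\<in>agents M. z (Good i j))) = 0)}"

lemma closed_near_equilibria: "closed (near_equilibria M \<epsilon>)"
  unfolding near_equilibria_def CC_def
  by (intro closed_Collect_conj closed_Collect_ball closed_Collect_le closed_Collect_eq
        continuous_intros continuous_on_coordinate continuous_on_spending)

text \<open>Dividing each agent's optimality condition by its multiplier gives spending the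
  coefficient 1, so the conditions can be added and the spending terms compared by market clearing.
  The allocation then minimises the weighted penalized delays, and the exact penalty forces all
  fractions to be 1.\<close>

lemma near_equilibria_nonempty:
  assumes valid: "valid_market M" and sf: "strong_feasibility M"
  obtains C where "\<And>\<epsilon>. 0 < \<epsilon> \<Longrightarrow> \<epsilon> \<le> 1 \<Longrightarrow> coord_box M C \<inter> near_equilibria M \<epsilon> \<noteq> {}"
proof -
  let ?A = "agents M" and ?G = "goods M"
  have fin: "finite ?A" "finite ?G"
    and m0: "\<And>i. i \<in> ?A \<Longrightarrow> 0 < budget M i"
    using valid by (auto simp: valid_market_def)
  obtain C where "C > 0" and penalty: "\<And>w X t i. \<lbrakk>\<And>i. i \<in> ?A \<Longrightarrow> 0 < w i; partial_allocation M X t;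
      \<And>X' t'. partial_allocation M X' t' \<Longrightarrow>
        (\<Sum>i\<in>?A. w i * penalized_delay M C i (X i) (t i)) \<le>
        (\<Sum>i\<in>?A. w i * penalized_delay M C i (X' i) (t' i));
      i \<in> ?A\<rbrakk> \<Longrightarrow> t i = 1"
    using exact_penalty[OF assms] by blast
  show thesis
  proof
    fix \<epsilon> :: real assume "0 < \<epsilon>" "\<epsilon> \<le> 1"
    obtain z where z_box: "z \<in> coord_box M C"
      and mult: "\<And>i. i \<in> ?A \<Longrightarrow> \<epsilon> \<le> z (Mult i)"
      and pa: "partial_allocation M (holding z) (\<lambda>i. z (Frac i))"
      and agent: "\<And>i x s. \<lbrakk>i \<in> ?A; scaled_CC M i x s; \<And>j. j \<in> ?G \<Longrightarrow> x j \<le> 2\<rbrakk> \<Longrightarrow>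
        penalized_delay M C i (holding z i) (z (Frac i)) + z (Mult i) * spending M z (holding z i) \<le>
        penalized_delay M C i x s + z (Mult i) * spending M z x"
      and afford: "\<And>i. i \<in> ?A \<Longrightarrow> spending M z (holding z i) \<le> budget M i"
      and compl: "\<And>i. i \<in> ?A \<Longrightarrow>
        (z (Mult i) - \<epsilon>) * (budget M i - spending M z (holding z i)) \<le> 0"
      and price: "\<And>j. j \<in> ?G \<Longrightarrow> z (Price j) * (1 - (\<Sum>i\<in>?A. z (Good i j))) = 0"
      using relaxed_equilibrium[OF valid \<open>C > 0\<close> \<open>0 < \<epsilon>\<close> \<open>\<epsilon> \<le> 1\<close>] by blast
    have z0: "0 \<le> z v" for v using z_box by (simp add: coord_box_def)
    have pos: "0 < z (Mult i)" if "i \<in> ?A" for i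
      using mult[OF that] \<open>0 < \<epsilon>\<close> by simp
    have total: "(\<Sum>i\<in>?A. spending M z (X i)) = (\<Sum>j\<in>?G. z (Price j) * (\<Sum>i\<in>?A. X i j))" for X
      unfolding spending_def by (subst sum.swap) (simp add: sum_distrib_left)
    have frac: "z (Frac i) = 1" if i: "i \<in> ?A" for i
    proof (rule penalty[where w = "\<lambda>i. 1 / z (Mult i)" and t = "\<lambda>i. z (Frac i)", OF _ pa _ i])
      fix X' t' assume pa': "partial_allocation M X' t'"
      define w where "w = (\<lambda>i. 1 / z (Mult i))"
      have "(\<Sum>i\<in>?A. w i * penalized_delay M C i (holding z i) (z (Frac i)) + spending M z (holding z i))
          \<le> (\<Sum>i\<in>?A. w i * penalized_delay M C i (X' i) (t' i) + spending M z (X' i))"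
      proof (rule sum_mono)
        fix i assume i: "i \<in> ?A"
        have "scaled_CC M i (X' i) (t' i)" using pa' i by (simp add: partial_allocation_def)
        moreover have "X' i j \<le> 2" if "j \<in> ?G" for j
          using partial_allocation_le_1[OF fin(1) pa' i that] by simp
        ultimately have "(penalized_delay M C i (holding z i) (z (Frac i)) + z (Mult i) * spending M z (holding z i)) / z (Mult i) \<le>
          (penalized_delay M C i (X' i) (t' i) + z (Mult i) * spending M z (X' i)) / z (Mult i)"
          using agent[OF i] pos[OF i] by (intro divide_right_mono) auto
        then show "w i * penalized_delay M C i (holding z i) (z (Frac i)) + spending M z (holding z i)
          \<le> w i * penalized_delay M C i (X' i) (t' i) + spending M z (X' i)"
          using pos[OF i] by (simp add: w_def add_divide_distrib)
      qed
      \<comment> \<open>Goods with a positive price are sold out in equilibrium, so the total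
        spending is the sum of all prices; no allocation within the supply can spend more.\<close>
      moreover have "(\<Sum>i\<in>?A. spending M z (X' i)) \<le> (\<Sum>i\<in>?A. spending M z (holding z i))"
      proof -
        have "(\<Sum>i\<in>?A. spending M z (X' i)) \<le> (\<Sum>j\<in>?G. z (Price j))"
          unfolding total using pa' z0
          by (intro sum_mono mult_left_le) (auto simp: partial_allocation_def supply_respecting_def)
        also have "\<dots> = (\<Sum>i\<in>?A. spending M z (holding z i))"
          unfolding total using price by (intro sum.cong) (auto simp: algebra_simps)
        finally show ?thesis .
      qed
      ultimately show "(\<Sum>i\<in>?A. 1 / z (Mult i) * penalized_delay M C i (holding z i) (z (Frac i)))
          \<le> (\<Sum>i\<in>?A. 1 / z (Mult i) * penalized_delay M C i (X' i) (t' i))"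
        by (simp add: w_def sum.distrib)
    qed (use pos in auto)
    have CC: "CC M i (holding z i)" if "i \<in> ?A" for i
      using pa that by (auto simp: partial_allocation_def frac scaled_CC_1)
    have opt: "(\<Sum>j\<in>?G. delay M i j * z (Good i j)) + z (Mult i) * spending M z (holding z i) \<le>
           (\<Sum>j\<in>?G. delay M i j * y j) + z (Mult i) * spending M z y"
      if i: "i \<in> ?A" and y: "CC M i y" for i y
    proof -
      \<comment> \<open>\<open>y\<close> may exceed the bound 2 of the box. This \<eta> makes every
        \<open>\<eta> * y j\<close> at most 1, so the mixture \<open>x\<close> is an admissible
        comparison; the cost \<open>c\<close> is affine, so the inequality passes from
        \<open>x\<close> to \<open>y\<close>.\<close>
      define \<eta> where "\<eta> = 1 / (1 + (\<Sum>j\<in>?G. y j))"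
      have y0: "0 \<le> y j" if "j \<in> ?G" for j using y that by (simp add: CC_def)
      have sum0: "0 \<le> (\<Sum>j\<in>?G. y j)" using y0 by (rule sum_nonneg)
      have \<eta>: "0 < \<eta>" "\<eta> \<le> 1" using sum0 by (auto simp: \<eta>_def)
      define x where "x = (\<lambda>j. z (Good i j) + \<eta> * (y j - z (Good i j)))"
      define c where "c = (\<lambda>x. (\<Sum>j\<in>?G. delay M i j * x j) + z (Mult i) * spending M z x)"
      have x_eq: "x j = (1 - \<eta>) * z (Good i j) + \<eta> * y j" for j by (simp add: x_def algebra_simps)
      have "req M i k \<le> (\<Sum>j\<in>?G. coef M i j k * x j)" if "k \<in> cidx M" for k
      proof -
        have "req M i k = (1 - \<eta>) * req M i k + \<eta> * req M i k" by (simp add: algebra_simps)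
        also have "\<dots> \<le> (1 - \<eta>) * (\<Sum>j\<in>?G. coef M i j k * z (Good i j)) + \<eta> * (\<Sum>j\<in>?G. coef M i j k * y j)"
          using CC[OF i] y that \<eta> by (intro add_mono mult_left_mono) (auto simp: CC_def)
        also have "\<dots> = (\<Sum>j\<in>?G. coef M i j k * x j)"
          by (simp add: x_eq sum_distrib_left sum.distrib algebra_simps sum_subtractf)
        finally show ?thesis .
      qed
      moreover have "0 \<le> x j" if "j \<in> ?G" for j
        using y0[OF that] z0 \<eta> by (simp add: x_eq)
      ultimately have "scaled_CC M i x 1" by (simp add: scaled_CC_1 CC_def)
      moreover have "x j \<le> 2" if j: "j \<in> ?G" for j
      proof -
        have "y j \<le> (\<Sum>j\<in>?G. y j)" using fin y0 j by (intro member_le_sum) auto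
        then have "\<eta> * y j \<le> 1" using sum0 by (simp add: \<eta>_def)
        moreover have "(1 - \<eta>) * z (Good i j) \<le> 1"
          using partial_allocation_le_1[OF fin(1) pa i j] \<eta> z0 by (simp add: mult_le_one)
        ultimately show ?thesis by (simp add: x_eq)
      qed
      ultimately have "c (holding z i) \<le> c x"
        using agent[OF i, of x 1] by (simp add: penalized_delay_def frac[OF i] c_def)
      also have "c x = c (holding z i) + \<eta> * (c y - c (holding z i))"
        unfolding c_def spending_def x_def
        by (simp add: algebra_simps sum.distrib sum_subtractf sum_distrib_left)
      finally have "0 \<le> c y - c (holding z i)" using \<eta> by (simp add: zero_le_mult_iff)
      then show ?thesis by (simp add: c_def)
    qed
    have "z (Mult i) * (budget M i - spending M z (holding z i)) \<le> \<epsilon> * budget M i" if i: "i \<in> ?A" for i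
    proof -
      have "0 \<le> spending M z (holding z i)"
        unfolding spending_def using z0 by (intro sum_nonneg) auto
      then have "0 \<le> \<epsilon> * spending M z (holding z i)" using \<open>0 < \<epsilon>\<close> by simp
      then show ?thesis using compl[OF i] by (simp add: algebra_simps)
    qed
    then have "z \<in> near_equilibria M \<epsilon>"
      using CC opt afford price pa
      by (simp add: near_equilibria_def partial_allocation_def supply_respecting_def)
    with z_box show "coord_box M C \<inter> near_equilibria M \<epsilon> \<noteq> {}" by blast
  qed
qed

section \<open>Passage to the limit\<close>

lemma near_equilibria_mono:
  assumes "valid_market M" and "\<epsilon> \<le> \<epsilon>'"
  shows "near_equilibria M \<epsilon> \<subseteq> near_equilibria M \<epsilon>'"
proof -
  have "\<epsilon> * budget M i \<le> \<epsilon>' * budget M i" if "i \<in> agents M" for i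
    using assms that by (intro mult_right_mono) (auto simp: valid_market_def intro: less_imp_le)
  then show ?thesis unfolding near_equilibria_def by (auto intro: order_trans)
qed

theorem theorem2p1:
  fixes M :: "('a, 'g, 'c) market"
  assumes "valid_market M"
    and "strong_feasibility M"
  shows "\<exists>X p. market_equilibrium M X p"
proof -
  have m0: "\<And>i. i \<in> agents M \<Longrightarrow> 0 < budget M i"
    using assms(1) by (auto simp: valid_market_def)
  obtain C where ne: "\<And>\<epsilon>. 0 < \<epsilon> \<Longrightarrow> \<epsilon> \<le> 1 \<Longrightarrow> coord_box M C \<inter> near_equilibria M \<epsilon> \<noteq> {}"
    using near_equilibria_nonempty[OF assms] by blast
  have "compact (coord_box M C)"
    unfolding coord_box_def using compact_function_box[of "\<lambda>_. 0" "coord_upper M C"] by simp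
  then have "coord_box M C \<inter> (\<Inter>n. near_equilibria M (1 / real (Suc n))) \<noteq> {}"
  proof (rule compact_imp_fip_image)
    fix N :: "nat set" assume "finite N"
    then obtain b where b: "\<And>n. n \<in> N \<Longrightarrow> n \<le> b"
      using finite_nat_set_iff_bounded_le by auto
    \<comment> \<open>The sets are nested, so each finite intersection contains the one with index
      \<open>b\<close>, which meets the box.\<close>
    have "near_equilibria M (1 / real (Suc b)) \<subseteq> near_equilibria M (1 / real (Suc n))" if "n \<in> N" for n
      using b[OF that] by (intro near_equilibria_mono assms) (simp add: field_simps)
    then show "coord_box M C \<inter> (\<Inter>n\<in>N. near_equilibria M (1 / real (Suc n))) \<noteq> {}"
      using ne[of "1 / real (Suc b)"] by fastforce
  qed (rule closed_near_equilibria)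
  then obtain z where z_box: "z \<in> coord_box M C"
    and z: "\<And>n. z \<in> near_equilibria M (1 / real (Suc n))" by blast
  have z0: "0 \<le> z v" for v using z_box by (simp add: coord_box_def)
  \<comment> \<open>The conditions free of \<epsilon> can be read off at the single index 0; only
    complementary slackness needs all \<open>n\<close>.\<close>
  note z_eq = z[of 0, unfolded near_equilibria_def, simplified]
  have compl: "z (Mult i) * (budget M i - spending M z (holding z i)) \<le> 0" if i: "i \<in> agents M" for i
  proof (rule LIMSEQ_le_const)
    have "(\<lambda>n. 1 / real (Suc n) * budget M i) \<longlonglongrightarrow> 0 * budget M i"
      by (intro tendsto_mult tendsto_const lim_1_over_n[THEN LIMSEQ_Suc])
    then show "(\<lambda>n. 1 / real (Suc n) * budget M i) \<longlonglongrightarrow> 0" by simp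
    have "z (Mult i) * (budget M i - spending M z (holding z i)) \<le> 1 / real (Suc n) * budget M i" for n
      using z[of n] i unfolding near_equilibria_def by blast
    then show "\<exists>N. \<forall>n\<ge>N. z (Mult i) * (budget M i - spending M z (holding z i)) \<le> 1 / real (Suc n) * budget M i"
      by blast
  qed
  have "optimal_bundle M (\<lambda>j. z (Price j)) i (holding z i)" if i: "i \<in> agents M" for i
    unfolding optimal_bundle_def
  proof (intro conjI allI impI)
    show "budget_feasible M (\<lambda>j. z (Price j)) i (holding z i)"
      using z_eq i by (simp add: budget_feasible_def spending_def)
    fix y assume y: "budget_feasible M (\<lambda>j. z (Price j)) i y"
    \<comment> \<open>Weak duality: \<open>y\<close> is affordable, and \<open>compl\<close> bounds
      the priced budget by the priced spending on the equilibrium bundle, so the multiplier terms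
      drop out of the Lagrangian inequality.\<close>
    then have "z (Mult i) * spending M z y \<le> z (Mult i) * budget M i"
      using z0 by (intro mult_left_mono) (auto simp: budget_feasible_def spending_def)
    moreover have "(\<Sum>j\<in>goods M. delay M i j * z (Good i j)) + z (Mult i) * spending M z (holding z i) \<le>
           (\<Sum>j\<in>goods M. delay M i j * y j) + z (Mult i) * spending M z y"
      using z_eq i y by (simp add: budget_feasible_def)
    ultimately show "(\<Sum>j\<in>goods M. delay M i j * z (Good i j)) \<le> (\<Sum>j\<in>goods M. delay M i j * y j)"
      using compl[OF i] by (simp add: algebra_simps)
  qed
  then have "market_equilibrium M (holding z) (\<lambda>j. z (Price j))"
    using z0 z_eq by (auto simp: market_equilibrium_def supply_respecting_def)
  then show ?thesis by blast
qed

end
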